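(* Let $I\subset\mathbb{R}$ be an interval, let $\Omega=\bigcup_{j=1}^m(I_j\times I_j)$ be a serrated domain with intervals $I_1,\dots,I_m$ covering $I$ indexed in their natural order, and let $K_\Omega$ be a partial covariance on $\Omega$. Consider the following recursive procedure. Start with the ordered list of intervals $(I_1,\dots,I_m)$ and the function $K_\Omega$ on $\Omega$. At each step, given an ordered list of intervals $(A_1,\dots,A_r)$, $r\ge 2$, and a function $K$ on $\bigcup_{j}(A_j\times A_j)$, choose any two successive intervals $A_p,A_{p+1}$, extend $K$ to $\big(\bigcup_j (A_j\times A_j)\big)\cup\big((A_p\cup A_{p+1})\times(A_p\cup A_{p+1})\big)$ by setting $$K(s,t)=\big\langle K(s,\cdot),K(\cdot,t)\big\rangle_{\mathscr{H}(K_{A_p\cap A_{p+1}})}$$ at all points $(s,t)$ of $(A_p\cup A_{p+1})^2$ at which $K$ was not yet defined, and replace $A_p,A_{p+1}$ in the list by $A_p\cup A_{p+1}$. Stop when the list consists of the single interval $I$. Then the output is a completion $K_\star\in\mathscr{C}(K_\Omega)$, and it is the same completion irrespective of the order in which the pairs of successive intervals are chosen. In particular, if $K_\Omega$ admits a unique completion, then this completion equals $K_\star$.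
   Context: A covariance on a set $S$ is a symmetric function $K:S\times S\to\mathbb{R}$ with $\sum_{i,j=1}^n\alpha_i\alpha_jK(t_i,t_j)\ge 0$ for all $n\ge1$, $t_i\in S$, $\alpha_i\in\mathbb{R}$. A serrated domain is a set $\Omega=\bigcup_{j=1}^m (I_j\times I_j)$ with $\{I_j\}_{j=1}^m$ a finite collection of (nonempty) subintervals covering $I$. Natural order means that for $p<q$ every point of $I_p\setminus I_q$ lies to the left of every point of $I_q$, and every point of $I_q\setminus I_p$ lies to the right of every point of $I_p$. A partial covariance on $\Omega$ is a function $K_\Omega:\Omega\to\mathbb{R}$ such that for every $J\subset I$ (not necessarily an interval) with $J\times J\subset\Omega$, the restriction $K_J=K_\Omega|_{J\times J}$ is a covariance on $J$. A completion of $K_\Omega$ is a covariance $K$ on $I$ with $K|_\Omega=K_\Omega$; the set of all completions is $\mathscr{C}(K_\Omega)$. For a covariance $K_J$ on a set $J$, $\mathscr{H}(K_J)$ denotes its reproducing kernel Hilbert space, with $\mathscr{H}(K_\emptyset)=\{0\}$; functions appearing inside an $\mathscr{H}(K_J)$-inner product are understood to be restricted to $J$, and $K_J=K|_{J\times J}$. *)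

theory Defs
  imports "HOL-Analysis.Analysis" "HOL-Library.FuncSet"
begin

text \<open>
  A function \<open>f : X \<rightarrow> \<real>\<close> on a set \<open>X\<close> is an element of \<open>X \<rightarrow>\<^sub>E UNIV\<close>, so that two functions on
  \<open>X\<close> agree if and only if they are equal as HOL functions. Kernels take pairs as arguments.
\<close>

definition covariance_on :: "'a set \<Rightarrow> ('a \<times> 'a \<Rightarrow> real) \<Rightarrow> bool" where
  "covariance_on S K \<longleftrightarrow>
     K \<in> S \<times> S \<rightarrow>\<^sub>E UNIV \<and>
     (\<forall>s\<in>S. \<forall>t\<in>S. K (s, t) = K (t, s)) \<and>
     (\<forall>n\<ge>1. \<forall>(t :: nat \<Rightarrow> 'a) (\<alpha> :: nat \<Rightarrow> real). (\<forall>i\<in>{1..n}. t i \<in> S) \<longrightarrow>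
        (\<Sum>i=1..n. \<Sum>j=1..n. \<alpha> i * \<alpha> j * K (t i, t j)) \<ge> 0)"

text \<open>
  A real Hilbert space \<open>(H, ip)\<close> of functions on \<open>S\<close> with the pointwise operations. The inner
  product is a function on \<open>H \<times> H\<close>; the last clause is completeness of the induced norm.
\<close>

definition hilbert_function_space ::
    "'a set \<Rightarrow> ('a \<Rightarrow> real) set \<Rightarrow> (('a \<Rightarrow> real) \<times> ('a \<Rightarrow> real) \<Rightarrow> real) \<Rightarrow> bool" where
  "hilbert_function_space S H ip \<longleftrightarrow>
     H \<subseteq> S \<rightarrow>\<^sub>E UNIV \<and>
     (\<lambda>x\<in>S. 0) \<in> H \<and>
     (\<forall>f\<in>H. \<forall>g\<in>H. (\<lambda>x\<in>S. f x + g x) \<in> H) \<and>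
     (\<forall>c. \<forall>f\<in>H. (\<lambda>x\<in>S. c * f x) \<in> H) \<and>
     ip \<in> H \<times> H \<rightarrow>\<^sub>E UNIV \<and>
     (\<forall>f\<in>H. \<forall>g\<in>H. ip (f, g) = ip (g, f)) \<and>
     (\<forall>f\<in>H. \<forall>g\<in>H. \<forall>h\<in>H. ip ((\<lambda>x\<in>S. f x + g x), h) = ip (f, h) + ip (g, h)) \<and>
     (\<forall>c. \<forall>f\<in>H. \<forall>h\<in>H. ip ((\<lambda>x\<in>S. c * f x), h) = c * ip (f, h)) \<and>
     (\<forall>f\<in>H. ip (f, f) \<ge> 0) \<and>
     (\<forall>f\<in>H. ip (f, f) = 0 \<longrightarrow> f = (\<lambda>x\<in>S. 0)) \<and>
     (let dist_H = (\<lambda>f g. sqrt (ip ((\<lambda>x\<in>S. f x - g x), (\<lambda>x\<in>S. f x - g x)))) in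
        \<forall>\<sigma> :: nat \<Rightarrow> 'a \<Rightarrow> real. (\<forall>n. \<sigma> n \<in> H) \<and>
            (\<forall>\<epsilon>>0. \<exists>N. \<forall>m\<ge>N. \<forall>n\<ge>N. dist_H (\<sigma> m) (\<sigma> n) < \<epsilon>) \<longrightarrow>
          (\<exists>f\<in>H. (\<lambda>n. dist_H (\<sigma> n) f) \<longlonglongrightarrow> 0))"

definition is_rkhs ::
    "'a set \<Rightarrow> ('a \<times> 'a \<Rightarrow> real) \<Rightarrow>
     ('a \<Rightarrow> real) set \<Rightarrow> (('a \<Rightarrow> real) \<times> ('a \<Rightarrow> real) \<Rightarrow> real) \<Rightarrow> bool" where
  "is_rkhs S K H ip \<longleftrightarrow>
     hilbert_function_space S H ip \<and>
     (\<forall>t\<in>S. (\<lambda>s\<in>S. K (t, s)) \<in> H) \<and>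
     (\<forall>t\<in>S. \<forall>f\<in>H. ip (f, (\<lambda>s\<in>S. K (t, s))) = f t)"

text \<open>
  By the Moore--Aronszajn theorem, exactly one pair \<open>(H, ip)\<close> qualifies when \<open>K\<close> is a covariance
  on \<open>S\<close>.
\<close>

definition rkhs ::
    "'a set \<Rightarrow> ('a \<times> 'a \<Rightarrow> real) \<Rightarrow>
     ('a \<Rightarrow> real) set \<times> (('a \<Rightarrow> real) \<times> ('a \<Rightarrow> real) \<Rightarrow> real)" where
  "rkhs S K = (THE (H, ip). is_rkhs S K H ip)"

definition rkhs_inner ::
    "'a set \<Rightarrow> ('a \<times> 'a \<Rightarrow> real) \<Rightarrow> ('a \<Rightarrow> real) \<Rightarrow> ('a \<Rightarrow> real) \<Rightarrow> real" where
  "rkhs_inner S K f g = snd (rkhs S K) (restrict f S, restrict g S)"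

text \<open>The convention for the empty index set is an instance of the general definition.\<close>

lemma rkhs_empty:
  "rkhs {} K = ({\<lambda>x\<in>{}. 0}, \<lambda>z\<in>{\<lambda>x\<in>{}. 0} \<times> {\<lambda>x\<in>{}. 0}. 0)"
proof -
  let ?z = "\<lambda>x. undefined :: real"
  have "is_rkhs {} K H ip \<longleftrightarrow> H = {?z} \<and> ip = (\<lambda>z\<in>{?z} \<times> {?z}. 0)" for H ip
  proof
    assume a: "is_rkhs {} K H ip"
    have H: "H = {?z}"
      using a by (auto simp: is_rkhs_def hilbert_function_space_def restrict_def)
    have ext: "ip \<in> extensional ({?z} \<times> {?z})"
      using a H by (auto simp: is_rkhs_def hilbert_function_space_def PiE_def)
    have "\<forall>c. \<forall>f\<in>H. \<forall>h\<in>H. ip ((\<lambda>x\<in>{}. c * f x), h) = c * ip (f, h)"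
      using a unfolding is_rkhs_def hilbert_function_space_def by blast
    then have "ip (?z, ?z) = 0 * ip (?z, ?z)"
      unfolding H by (auto simp: restrict_def dest: spec[of _ 0])
    then have "ip = (\<lambda>z\<in>{?z} \<times> {?z}. 0)"
      using ext by (intro extensionalityI[of _ "{?z} \<times> {?z}"]) auto
    with H show "H = {?z} \<and> ip = (\<lambda>z\<in>{?z} \<times> {?z}. 0)" by blast
  next
    assume "H = {?z} \<and> ip = (\<lambda>z\<in>{?z} \<times> {?z}. 0)"
    then show "is_rkhs {} K H ip"
      by (auto simp: is_rkhs_def hilbert_function_space_def restrict_def Let_def)
  qed
  then show ?thesis
    unfolding rkhs_def restrict_def by (intro the_equality) auto
qed

definition squares :: "'a set list \<Rightarrow> ('a \<times> 'a) set" where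
  "squares As = (\<Union>A\<in>set As. A \<times> A)"

definition interval_cover :: "real set \<Rightarrow> real set list \<Rightarrow> bool" where
  "interval_cover I As \<longleftrightarrow>
     As \<noteq> [] \<and> (\<forall>A\<in>set As. is_interval A \<and> A \<noteq> {} \<and> A \<subseteq> I) \<and> I \<subseteq> \<Union>(set As)"

definition natural_order :: "real set list \<Rightarrow> bool" where
  "natural_order As \<longleftrightarrow>
     (\<forall>p q. p < q \<and> q < length As \<longrightarrow>
        (\<forall>x \<in> As ! p - As ! q. \<forall>y \<in> As ! q. x < y) \<and>
        (\<forall>y \<in> As ! q - As ! p. \<forall>x \<in> As ! p. x < y))"

definition partial_covariance :: "'a set \<Rightarrow> ('a \<times> 'a) set \<Rightarrow> ('a \<times> 'a \<Rightarrow> real) \<Rightarrow> bool" where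
  "partial_covariance I \<Omega> K \<longleftrightarrow>
     K \<in> \<Omega> \<rightarrow>\<^sub>E UNIV \<and>
     (\<forall>J\<subseteq>I. J \<times> J \<subseteq> \<Omega> \<longrightarrow> covariance_on J (restrict K (J \<times> J)))"

definition completions :: "'a set \<Rightarrow> ('a \<times> 'a) set \<Rightarrow> ('a \<times> 'a \<Rightarrow> real) \<Rightarrow> ('a \<times> 'a \<Rightarrow> real) set" where
  "completions I \<Omega> K\<^sub>\<Omega> = {K. covariance_on I K \<and> restrict K \<Omega> = K\<^sub>\<Omega>}"

text \<open>
  \<open>K\<close> is a function on \<open>squares As\<close>; the result is a function on
  \<open>squares As \<union> (A \<union> B) \<times> (A \<union> B)\<close>.
\<close>

definition merge_extension ::
    "'a set list \<Rightarrow> 'a set \<Rightarrow> 'a set \<Rightarrow> ('a \<times> 'a \<Rightarrow> real) \<Rightarrow> ('a \<times> 'a \<Rightarrow> real)" where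
  "merge_extension As A B K = (\<lambda>(s, t).
     if (s, t) \<in> (A \<union> B) \<times> (A \<union> B) - squares As
     then rkhs_inner (A \<inter> B) (restrict K ((A \<inter> B) \<times> (A \<inter> B))) (\<lambda>u. K (s, u)) (\<lambda>u. K (u, t))
     else K (s, t))"

inductive merge_step ::
    "'a set list \<times> ('a \<times> 'a \<Rightarrow> real) \<Rightarrow> 'a set list \<times> ('a \<times> 'a \<Rightarrow> real) \<Rightarrow> bool" where
  "merge_step (xs @ A # B # ys, K)
     (xs @ (A \<union> B) # ys, merge_extension (xs @ A # B # ys) A B K)"

end

theory Submission
  imports Defs
begin

text \<open>
  Regard \<open>K(s, t)\<close> as the inner product of feature vectors \<open>k\<^sub>s\<close>, \<open>k\<^sub>t\<close>. The inner product of \<open>K(s, \<cdot>)\<close> and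
  \<open>K(\<cdot>, t)\<close> over a set \<open>D\<close> is then \<open>\<langle>P\<^sub>D k\<^sub>s, P\<^sub>D k\<^sub>t\<rangle>\<close> with \<open>P\<^sub>D\<close> the projection to the closed span of the
  \<open>k\<^sub>u\<close>, \<open>u \<in> D\<close>. So a merge of \<open>A\<close> and \<open>B\<close> chooses the missing values such that \<open>A \<inter> B\<close> separates \<open>A\<close> from
  \<open>B\<close> (\<open>separates\<close>): for a Gaussian process, the two parts become conditionally independent given the values
  on the overlap.

  The output is a covariance because each merge glues two covariances into one. The form on \<open>A \<union> B\<close> of a
  combination \<open>a + b\<close> dominates \<open>\<parallel>P\<^sub>D (k\<^sub>a + k\<^sub>b)\<parallel>\<^sup>2\<close>, where \<open>D = A \<inter> B\<close> (\<open>positive_kernel_glue\<close>).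

  The output does not depend on the order because it can be characterised without reference to it. After
  any number of merges, the current intervals are unions of consecutive original ones, and two adjacent
  unions \<open>I\<^sub>a \<union> \<dots> \<union> I\<^sub>b\<close> and \<open>I\<^bsub>b+1\<^esub> \<union> \<dots> \<union> I\<^sub>c\<close> overlap in \<open>I\<^sub>b \<inter> I\<^bsub>b+1\<^esub>\<close> only (\<open>blocks_inter\<close>). The invariant
  \<open>cut_separated\<close> says that inside every current interval each \<open>I\<^sub>p \<inter> I\<^bsub>p+1\<^esub>\<close> separates the union of the
  intervals up to \<open>I\<^sub>p\<close> from the union of those after it. A merge creates this property at the new cut by definition; that it extends
  the property at the old cuts to the larger interval is the contraction property of conditional
  independence (\<open>separates_trans\<close>, used in \<open>cut_separated_append\<close>). Finally, a covariance with the given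
  values on the squares and with the cut property on all of \<open>I\<close> is unique, by induction along the list of
  intervals (\<open>cut_separated_unique\<close>). If only one completion exists, it must be this one.

  All of this needs the reproducing kernel Hilbert space to exist and to be unique. It is realised as the
  dual of the seminormed space of finite formal combinations of points: with \<open>B\<close> the form induced by
  \<open>K\<close>, the squared norm of \<open>f\<close> is the supremum of \<open>2 f(v) - B(v, v)\<close>, and near-maximisers \<open>v\<close> give
  kernel combinations close to \<open>f\<close> (\<open>rk_shift\<close>). Approximation by kernel combinations then
  yields the inner product, and also replaces projections throughout.
\<close>

section \<open>Finite linear combinations and their pairing with functions\<close>

text \<open>
A finite formal combination \<open>\<Sum>\<^sub>i a\<^sub>i \<delta>\<^bsub>x\<^sub>i\<^esub>\<close> is encoded as the list of its pairs \<open>(x\<^sub>i, a\<^sub>i)\<close>. Repetitions are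
harmless, because only the pairing \<open>ev\<close> with functions is ever used: under it, concatenation acts as
addition, and no quotient by rearrangement has to be formed.
\<close>

definition combos :: "'a set \<Rightarrow> ('a \<times> real) list set" where
  "combos S = {v. fst ` set v \<subseteq> S}"

definition ev :: "('a \<Rightarrow> real) \<Rightarrow> ('a \<times> real) list \<Rightarrow> real" where
  "ev f v = (\<Sum>(x, a)\<leftarrow>v. a * f x)"

definition scale :: "real \<Rightarrow> ('a \<times> real) list \<Rightarrow> ('a \<times> real) list" where
  "scale c v = map (\<lambda>(x, a). (x, c * a)) v"

text \<open>
The function \<open>\<Sum>\<^sub>i a\<^sub>i K(x\<^sub>i, \<cdot>)\<close> represented by a formal combination, and the bilinear form
\<open>\<Sum>\<^sub>i\<^sub>,\<^sub>j a\<^sub>i b\<^sub>j K(x\<^sub>i, y\<^sub>j)\<close> that \<open>K\<close> induces on formal combinations. Comments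
below abbreviate them to \<open>k\<^sub>v\<close> and \<open>B(v, w)\<close>.
\<close>

definition kcomb :: "('a \<times> 'a \<Rightarrow> real) \<Rightarrow> ('a \<times> real) list \<Rightarrow> 'a \<Rightarrow> real" where
  "kcomb K v = (\<lambda>t. ev (\<lambda>s. K (s, t)) v)"

definition kform :: "('a \<times> 'a \<Rightarrow> real) \<Rightarrow> ('a \<times> real) list \<Rightarrow> ('a \<times> real) list \<Rightarrow> real" where
  "kform K v w = ev (kcomb K v) w"

lemma combos_simps [simp]:
  "[] \<in> combos S"
  "(x, a) # v \<in> combos S \<longleftrightarrow> x \<in> S \<and> v \<in> combos S"
  "v @ w \<in> combos S \<longleftrightarrow> v \<in> combos S \<and> w \<in> combos S"
  by (auto simp: combos_def)

lemma combos_scale [simp]: "v \<in> combos S \<Longrightarrow> scale c v \<in> combos S"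
  by (force simp: combos_def scale_def)

lemma combos_mono: "v \<in> combos S \<Longrightarrow> S \<subseteq> T \<Longrightarrow> v \<in> combos T"
  by (auto simp: combos_def)

lemma ev_simps [simp]:
  "ev f [] = 0"
  "ev f ((x, a) # v) = a * f x + ev f v"
  "ev f (v @ w) = ev f v + ev f w"
  by (auto simp: ev_def)

lemma ev_scale [simp]: "ev f (scale c v) = c * ev f v"
  by (induction v) (auto simp: scale_def ev_def algebra_simps)

lemma ev_add: "ev (\<lambda>x. f x + g x) v = ev f v + ev g v"
  by (induction v) (auto simp: ev_def algebra_simps)

lemma ev_diff: "ev (\<lambda>x. f x - g x) v = ev f v - ev g v"
  by (induction v) (auto simp: ev_def algebra_simps)

lemma ev_cmult: "ev (\<lambda>x. c * f x) v = c * ev f v"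
  by (induction v) (auto simp: ev_def algebra_simps)

lemma ev_zero [simp]: "ev (\<lambda>x. 0) v = 0"
  by (induction v) (auto simp: ev_def)

lemma ev_cong: "v \<in> combos S \<Longrightarrow> (\<And>x. x \<in> S \<Longrightarrow> f x = g x) \<Longrightarrow> ev f v = ev g v"
  by (induction v) auto

lemma ev_swap: "ev (\<lambda>s. ev (\<lambda>t. F s t) w) v = ev (\<lambda>t. ev (\<lambda>s. F s t) v) w"
  by (induction v) (auto simp: ev_add ev_cmult)

lemma tendsto_ev: "(\<And>x. x \<in> S \<Longrightarrow> (\<lambda>n. \<sigma> n x) \<longlonglongrightarrow> f x) \<Longrightarrow> v \<in> combos S
    \<Longrightarrow> (\<lambda>n. ev (\<sigma> n) v) \<longlonglongrightarrow> ev f v"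
  by (induction v) (auto intro!: tendsto_intros)

lemma kcomb_simps [simp]:
  "kcomb K [] = (\<lambda>t. 0)"
  "kcomb K ((s, a) # v) = (\<lambda>t. a * K (s, t) + kcomb K v t)"
  "kcomb K (v @ w) = (\<lambda>t. kcomb K v t + kcomb K w t)"
  "kcomb K (scale c v) = (\<lambda>t. c * kcomb K v t)"
  by (auto simp: kcomb_def)

lemma kform_simps [simp]:
  "kform K [] w = 0"
  "kform K v [] = 0"
  "kform K (v @ v') w = kform K v w + kform K v' w"
  "kform K v (w @ w') = kform K v w + kform K v w'"
  "kform K (scale c v) w = c * kform K v w"
  "kform K v (scale c w) = c * kform K v w"
  by (auto simp: kform_def ev_add ev_cmult)

lemma ev_kcomb: "ev (kcomb K v) w = kform K v w"
  by (simp add: kform_def)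

section \<open>Quadratic inequalities and their use for sequences\<close>

text \<open>
The discriminant argument behind every Cauchy--Schwarz inequality below: optimise over \<open>c\<close>, and when
\<open>b = 0\<close> let \<open>c\<close> grow until the linear term would violate the bound.
\<close>

lemma sq_le_of_quadratic_bound:
  fixes a b q :: real
  assumes "b \<ge> 0" and bound: "\<And>c. 2 * c * a - c\<^sup>2 * b \<le> q"
  shows "a\<^sup>2 \<le> q * b"
proof (cases "b = 0")
  case True
  have "a = 0"
  proof (rule ccontr)
    assume "a \<noteq> 0"
    then have "2 * ((\<bar>q\<bar> + 1) / a) * a = 2 * (\<bar>q\<bar> + 1)"
      by simp
    with bound[of "(\<bar>q\<bar> + 1) / a"] True show False
      by simp
  qed
  then show ?thesis using True by simp
next
  case False
  then have "b > 0" using \<open>b \<ge> 0\<close> by simp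
  have "2 * (a / b) * a - (a / b)\<^sup>2 * b = a\<^sup>2 / b"
    using \<open>b > 0\<close> by (simp add: field_simps power2_eq_square)
  with bound[of "a / b"] have "a\<^sup>2 / b \<le> q" by simp
  then show ?thesis using \<open>b > 0\<close> by (simp add: field_simps)
qed

lemma quadratic_bound_of_sq_le:
  fixes a b c :: real
  assumes "b \<ge> 0" "c \<ge> 0" "a\<^sup>2 \<le> c * b"
  shows "2 * a - b \<le> c"
proof -
  have "(2 * a)\<^sup>2 \<le> (c + b)\<^sup>2"
    using assms(3) zero_le_power2[of "c - b"] by (simp add: power2_eq_square algebra_simps)
  then have "2 * a \<le> c + b"
    using assms(1,2) by (meson add_nonneg_nonneg power2_le_imp_le)
  then show ?thesis by simp
qed

lemma tendsto_zero_of_sq_le: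
  fixes z e :: "nat \<Rightarrow> real"
  assumes "\<And>n. (z n)\<^sup>2 \<le> e n" "e \<longlonglongrightarrow> 0"
  shows "z \<longlonglongrightarrow> 0"
proof -
  have "(\<lambda>n. (z n)\<^sup>2) \<longlonglongrightarrow> 0"
    by (rule tendsto_sandwich[OF _ _ tendsto_const assms(2)]) (auto intro!: always_eventually assms(1))
  then show ?thesis by simp
qed

lemma Cauchy_of_sq_dist_le:
  fixes z e :: "nat \<Rightarrow> real"
  assumes "\<And>m n. (z m - z n)\<^sup>2 \<le> e m + e n" "e \<longlonglongrightarrow> 0"
  shows "Cauchy z"
proof (rule CauchyI)
  fix r :: real
  assume "r > 0"
  then have "\<forall>\<^sub>F n in sequentially. e n < r\<^sup>2 / 2"
    by (intro order_tendstoD[OF assms(2)]) auto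
  then obtain N where N: "\<And>n. n \<ge> N \<Longrightarrow> e n < r\<^sup>2 / 2"
    by (auto simp: eventually_sequentially)
  have "\<bar>z m - z n\<bar> < r" if "m \<ge> N" "n \<ge> N" for m n
  proof -
    have "\<bar>z m - z n\<bar>\<^sup>2 < r\<^sup>2"
      using assms(1)[of m n] N[OF that(1)] N[OF that(2)] by simp
    then show ?thesis
      using \<open>r > 0\<close> power2_less_imp_less by fastforce
  qed
  then show "\<exists>M. \<forall>m\<ge>M. \<forall>n\<ge>M. norm (z m - z n) < r" by auto
qed

section \<open>Positive kernels and the dual norm\<close>

text \<open>
A covariance without the requirement that it be undefined outside \<open>S \<times> S\<close>. One function \<open>K\<close> can then be
a positive kernel on many sets at once, which is the situation during the merging procedure.
\<close>

locale positive_kernel =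
  fixes S :: "'a set" and K :: "'a \<times> 'a \<Rightarrow> real"
  assumes kernel_sym: "s \<in> S \<Longrightarrow> t \<in> S \<Longrightarrow> K (s, t) = K (t, s)"
    and kform_nonneg: "v \<in> combos S \<Longrightarrow> kform K v v \<ge> 0"

lemma positive_kernel_subset: "positive_kernel A K \<Longrightarrow> D \<subseteq> A \<Longrightarrow> positive_kernel D K"
  unfolding positive_kernel_def by (meson combos_mono subsetD)

lemma positive_kernel_cong:
  assumes "positive_kernel S K" "\<And>s t. s \<in> S \<Longrightarrow> t \<in> S \<Longrightarrow> K (s, t) = K' (s, t)"
  shows "positive_kernel S K'"
proof -
  have "kform K v v = kform K' v v" if "v \<in> combos S" for v
    unfolding kform_def kcomb_def using that assms(2) by (intro ev_cong) auto
  then show ?thesis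
    using assms by (auto simp: positive_kernel_def)
qed

lemma covariance_on_iff_positive_kernel:
  "covariance_on S (restrict K (S \<times> S)) \<longleftrightarrow> positive_kernel S K"
proof -
  have form: "(\<Sum>i=1..n. \<Sum>j=1..n. \<alpha> i * \<alpha> j * restrict K (S \<times> S) (t i, t j))
      = kform K (map (\<lambda>i. (t i, \<alpha> i)) [1..<Suc n]) (map (\<lambda>i. (t i, \<alpha> i)) [1..<Suc n])"
    if "\<forall>i\<in>{1..n}. t i \<in> S" for n :: nat and t \<alpha>
  proof -
    have "kform K (map (\<lambda>i. (t i, \<alpha> i)) [1..<Suc n]) (map (\<lambda>i. (t i, \<alpha> i)) [1..<Suc n])
        = (\<Sum>j=1..n. \<alpha> j * (\<Sum>i=1..n. \<alpha> i * K (t i, t j)))"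
      by (simp only: kform_def kcomb_def ev_def map_map o_def split_conv
          interv_sum_list_conv_sum_set_nat atLeastLessThanSuc_atLeastAtMost set_upt)
    also have "\<dots> = (\<Sum>i=1..n. \<Sum>j=1..n. \<alpha> i * \<alpha> j * K (t i, t j))"
      by (subst sum.swap) (simp add: sum_distrib_left mult_ac)
    also have "\<dots> = (\<Sum>i=1..n. \<Sum>j=1..n. \<alpha> i * \<alpha> j * restrict K (S \<times> S) (t i, t j))"
      using that by (intro sum.cong) auto
    finally show ?thesis by simp
  qed
  show ?thesis
  proof
    assume cov: "covariance_on S (restrict K (S \<times> S))"
    show "positive_kernel S K"
    proof
      fix s t assume "s \<in> S" "t \<in> S"
      then show "K (s, t) = K (t, s)"
        using cov by (auto simp: covariance_on_def)
    next
      fix v :: "('a \<times> real) list" assume v: "v \<in> combos S"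
      \<comment> \<open>The definition of a covariance numbers its points from 1, lists from 0.\<close>
      define n where "n = length v"
      define t where "t = (\<lambda>i. fst (v ! (i - 1)))"
      define \<alpha> where "\<alpha> = (\<lambda>i. snd (v ! (i - 1)))"
      have v_eq: "v = map (\<lambda>i. (t i, \<alpha> i)) [1..<Suc n]"
        by (rule nth_equalityI) (auto simp: n_def t_def \<alpha>_def simp del: upt_Suc)
      have tS: "\<forall>i\<in>{1..n}. t i \<in> S"
        using v by (auto simp: combos_def n_def t_def image_subset_iff)
      show "kform K v v \<ge> 0"
      proof (cases "n = 0")
        case True
        then show ?thesis by (simp add: n_def)
      next
        case False
        then have "n \<ge> 1" by simp
        then have "(\<Sum>i=1..n. \<Sum>j=1..n. \<alpha> i * \<alpha> j * restrict K (S \<times> S) (t i, t j)) \<ge> 0"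
          using cov tS unfolding covariance_on_def by blast
        then show ?thesis
          by (subst (asm) form[OF tS]) (simp only: v_eq[symmetric])
      qed
    qed
  next
    assume "positive_kernel S K"
    then interpret positive_kernel S K .
    show "covariance_on S (restrict K (S \<times> S))"
      unfolding covariance_on_def
    proof (intro conjI ballI allI impI)
      fix n :: nat and t \<alpha> assume tS: "\<forall>i\<in>{1..n}. t i \<in> S"
      then have "map (\<lambda>i. (t i, \<alpha> i)) [1..<Suc n] \<in> combos S"
        by (auto simp: combos_def)
      then show "(\<Sum>i=1..n. \<Sum>j=1..n. \<alpha> i * \<alpha> j * restrict K (S \<times> S) (t i, t j)) \<ge> 0"
        unfolding form[OF tS] by (rule kform_nonneg)
    qed (auto simp: kernel_sym)
  qed
qed

text \<open>
For a positive kernel, \<open>f\<close> lies in the reproducing kernel Hilbert space if and only if the functional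
\<open>v \<mapsto> ev f v\<close> is bounded for the seminorm \<open>sqrt (kform K v v)\<close>, and its squared norm is that of the
functional. The least \<open>c\<close> with \<open>(ev f v)\<^sup>2 \<le> c * kform K v v\<close> equals the supremum of
\<open>2 * ev f v - kform K v v\<close>, as replacing \<open>v\<close> by its multiples shows. The supremum is preferred because
it has no square roots and completes the square when \<open>f\<close> is shifted by a kernel combination.
\<close>

definition rk_bounded :: "'a set \<Rightarrow> ('a \<times> 'a \<Rightarrow> real) \<Rightarrow> ('a \<Rightarrow> real) \<Rightarrow> bool" where
  "rk_bounded S K f \<longleftrightarrow> bdd_above ((\<lambda>v. 2 * ev f v - kform K v v) ` combos S)"

definition rk_sqnorm :: "'a set \<Rightarrow> ('a \<times> 'a \<Rightarrow> real) \<Rightarrow> ('a \<Rightarrow> real) \<Rightarrow> real" where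
  "rk_sqnorm S K f = (SUP v\<in>combos S. 2 * ev f v - kform K v v)"

lemma rk_cong:
  assumes "\<And>x. x \<in> S \<Longrightarrow> f x = g x"
  shows "rk_bounded S K f = rk_bounded S K g" "rk_sqnorm S K f = rk_sqnorm S K g"
proof -
  have "(\<lambda>v. 2 * ev f v - kform K v v) ` combos S = (\<lambda>v. 2 * ev g v - kform K v v) ` combos S"
    using ev_cong[of _ S f g] assms by (intro image_cong) auto
  then show "rk_bounded S K f = rk_bounded S K g" "rk_sqnorm S K f = rk_sqnorm S K g"
    unfolding rk_bounded_def rk_sqnorm_def by simp_all
qed

lemma rk_upper: "rk_bounded S K f \<Longrightarrow> v \<in> combos S \<Longrightarrow> 2 * ev f v - kform K v v \<le> rk_sqnorm S K f"
  unfolding rk_bounded_def rk_sqnorm_def by (rule cSUP_upper)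

lemma rk_least:
  assumes "\<And>v. v \<in> combos S \<Longrightarrow> 2 * ev f v - kform K v v \<le> c"
  shows "rk_bounded S K f" "rk_sqnorm S K f \<le> c"
proof -
  show "rk_bounded S K f"
    unfolding rk_bounded_def using assms by (rule bdd_aboveI2)
  have "combos S \<noteq> {}" using combos_simps(1) by blast
  then show "rk_sqnorm S K f \<le> c"
    unfolding rk_sqnorm_def using assms by (intro cSUP_least) auto
qed

lemma rk_sqnorm_nonneg: "rk_bounded S K f \<Longrightarrow> rk_sqnorm S K f \<ge> 0"
  using rk_upper[of S K f "[]"] by simp

context positive_kernel
begin

lemma kform_sym: "v \<in> combos S \<Longrightarrow> w \<in> combos S \<Longrightarrow> kform K v w = kform K w v"
proof -
  assume v: "v \<in> combos S" and w: "w \<in> combos S"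
  have "kform K v w = ev (\<lambda>s. ev (\<lambda>t. K (s, t)) w) v"
    unfolding kform_def kcomb_def by (rule ev_swap)
  also have "\<dots> = kform K w v"
    unfolding kform_def kcomb_def using v w by (intro ev_cong) (auto simp: kernel_sym)
  finally show ?thesis .
qed

lemma ev_sq_le:
  assumes f: "rk_bounded S K f" and v: "v \<in> combos S"
  shows "(ev f v)\<^sup>2 \<le> rk_sqnorm S K f * kform K v v"
proof (rule sq_le_of_quadratic_bound)
  fix c :: real
  show "2 * c * ev f v - c\<^sup>2 * kform K v v \<le> rk_sqnorm S K f"
    using rk_upper[OF f, of "scale c v"] v by (simp add: power2_eq_square mult_ac)
qed (rule kform_nonneg[OF v])

lemma rk_bound_of_sq_le:
  assumes "c \<ge> 0" "\<And>v. v \<in> combos S \<Longrightarrow> (ev f v)\<^sup>2 \<le> c * kform K v v"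
  shows "rk_bounded S K f" "rk_sqnorm S K f \<le> c"
  using assms by (auto intro!: rk_least quadratic_bound_of_sq_le kform_nonneg)

lemma rk_cmult:
  assumes "rk_bounded S K f"
  shows "rk_bounded S K (\<lambda>x. c * f x)" "rk_sqnorm S K (\<lambda>x. c * f x) \<le> c\<^sup>2 * rk_sqnorm S K f"
proof -
  have "(ev (\<lambda>x. c * f x) v)\<^sup>2 \<le> c\<^sup>2 * rk_sqnorm S K f * kform K v v" if "v \<in> combos S" for v
    using mult_left_mono[OF ev_sq_le[OF assms that], of "c\<^sup>2"]
    by (simp add: ev_cmult power_mult_distrib mult_ac)
  note bound = rk_bound_of_sq_le[OF _ this]
  show "rk_bounded S K (\<lambda>x. c * f x)" "rk_sqnorm S K (\<lambda>x. c * f x) \<le> c\<^sup>2 * rk_sqnorm S K f"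
    using rk_sqnorm_nonneg[OF assms] by (auto intro: bound)
qed

lemma rk_add:
  assumes f: "rk_bounded S K f" and g: "rk_bounded S K g"
  shows "rk_bounded S K (\<lambda>x. f x + g x)"
    "rk_sqnorm S K (\<lambda>x. f x + g x) \<le> 2 * rk_sqnorm S K f + 2 * rk_sqnorm S K g"
proof -
  have "2 * ev (\<lambda>x. f x + g x) v - kform K v v \<le> 2 * rk_sqnorm S K f + 2 * rk_sqnorm S K g"
    if "v \<in> combos S" for v
    using rk_cmult(2)[OF f, of 2] rk_cmult(2)[OF g, of 2]
      rk_upper[OF rk_cmult(1)[OF f, of 2] that] rk_upper[OF rk_cmult(1)[OF g, of 2] that]
    by (simp add: ev_add ev_cmult)
  then show "rk_bounded S K (\<lambda>x. f x + g x)"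
    "rk_sqnorm S K (\<lambda>x. f x + g x) \<le> 2 * rk_sqnorm S K f + 2 * rk_sqnorm S K g"
    by (auto intro: rk_least)
qed

lemma rk_diff:
  assumes f: "rk_bounded S K f" and g: "rk_bounded S K g"
  shows "rk_bounded S K (\<lambda>x. f x - g x)"
    "rk_sqnorm S K (\<lambda>x. f x - g x) \<le> 2 * rk_sqnorm S K f + 2 * rk_sqnorm S K g"
  using rk_add[OF f rk_cmult(1)[OF g, of "-1"]] rk_cmult(2)[OF g, of "-1"] by auto

lemma rk_zero: "rk_bounded S K (\<lambda>x. 0)" "rk_sqnorm S K (\<lambda>x. 0) = 0"
proof -
  have *: "2 * ev (\<lambda>x. 0) v - kform K v v \<le> 0" if "v \<in> combos S" for v
    using kform_nonneg[OF that] by simp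
  show b: "rk_bounded S K (\<lambda>x. 0)" by (rule rk_least(1)[OF *])
  show "rk_sqnorm S K (\<lambda>x. 0) = 0"
    using rk_least(2)[of S "\<lambda>x. 0", OF *] rk_sqnorm_nonneg[OF b] by simp
qed

text \<open>
Completing the square: \<open>2 (f - k\<^sub>v)(w) - B(w, w)\<close> differs from \<open>2 f(v + w) - B(v + w, v + w)\<close> by the
constant \<open>2 f(v) - B(v, v)\<close>. Since \<open>w \<mapsto> v + w\<close> is a translation, the two suprema differ by exactly that
constant; the reverse inequality is the same statement for the shift back by \<open>-v\<close>.
\<close>

lemma rk_shift_le:
  assumes f: "rk_bounded S K f" and v: "v \<in> combos S"
  shows "rk_bounded S K (\<lambda>x. f x - kcomb K v x)"
    "rk_sqnorm S K (\<lambda>x. f x - kcomb K v x) \<le> rk_sqnorm S K f - (2 * ev f v - kform K v v)"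
proof -
  have "2 * ev (\<lambda>x. f x - kcomb K v x) w - kform K w w
      \<le> rk_sqnorm S K f - (2 * ev f v - kform K v v)" if w: "w \<in> combos S" for w
    using rk_upper[OF f, of "v @ w"] v w kform_sym[OF v w] by (simp add: ev_diff ev_kcomb)
  then show "rk_bounded S K (\<lambda>x. f x - kcomb K v x)"
    "rk_sqnorm S K (\<lambda>x. f x - kcomb K v x) \<le> rk_sqnorm S K f - (2 * ev f v - kform K v v)"
    by (auto intro: rk_least)
qed

lemma rk_shift:
  assumes f: "rk_bounded S K f" and v: "v \<in> combos S"
  shows "rk_sqnorm S K (\<lambda>x. f x - kcomb K v x) = rk_sqnorm S K f - (2 * ev f v - kform K v v)"
proof (rule antisym)
  show "rk_sqnorm S K (\<lambda>x. f x - kcomb K v x) \<le> rk_sqnorm S K f - (2 * ev f v - kform K v v)"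
    by (rule rk_shift_le(2)[OF f v])
  show "rk_sqnorm S K f - (2 * ev f v - kform K v v) \<le> rk_sqnorm S K (\<lambda>x. f x - kcomb K v x)"
    using rk_shift_le(2)[OF rk_shift_le(1)[OF f v] combos_scale[OF v, of "-1"]]
    by (simp add: ev_diff ev_kcomb)
qed

lemma rk_kcomb:
  assumes v: "v \<in> combos S"
  shows "rk_bounded S K (kcomb K v)" "rk_sqnorm S K (kcomb K v) = kform K v v"
  using rk_shift_le(1)[OF rk_zero(1) combos_scale[OF v, of "-1"]]
    rk_shift[OF rk_zero(1) combos_scale[OF v, of "-1"]] rk_zero(2) by auto

text \<open>
Density of the kernel combinations and the Riesz representation in one stroke: by
\<open>rk_shift\<close>, the squared distance from \<open>f\<close> to \<open>k\<^sub>v\<close> is the amount by which \<open>v\<close> fails to attain the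
supremum that defines the squared norm of \<open>f\<close>.
\<close>

lemma kcomb_dense:
  assumes f: "rk_bounded S K f" and "\<epsilon> > 0"
  shows "\<exists>v\<in>combos S. rk_sqnorm S K (\<lambda>x. f x - kcomb K v x) < \<epsilon>"
proof -
  have "combos S \<noteq> {}" using combos_simps(1) by blast
  then obtain v where v: "v \<in> combos S" "rk_sqnorm S K f - \<epsilon> < 2 * ev f v - kform K v v"
    using less_cSUP_iff[of "combos S" "\<lambda>v. 2 * ev f v - kform K v v" "rk_sqnorm S K f - \<epsilon>"]
      f \<open>\<epsilon> > 0\<close> by (auto simp: rk_bounded_def rk_sqnorm_def)
  then show ?thesis
    using rk_shift[OF f v(1)] by (intro bexI[of _ v]) auto
qed

definition approximates :: "(nat \<Rightarrow> ('a \<times> real) list) \<Rightarrow> ('a \<Rightarrow> real) \<Rightarrow> bool" where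
  "approximates \<beta> f \<longleftrightarrow> (\<forall>n. \<beta> n \<in> combos S) \<and>
     (\<lambda>n. rk_sqnorm S K (\<lambda>x. f x - kcomb K (\<beta> n) x)) \<longlonglongrightarrow> 0"

lemma approximates_exists:
  assumes f: "rk_bounded S K f"
  shows "\<exists>\<beta>. approximates \<beta> f"
proof -
  have "\<exists>v. v \<in> combos S \<and> rk_sqnorm S K (\<lambda>x. f x - kcomb K v x) < 1 / real (Suc n)" for n
    using kcomb_dense[OF f, of "1 / real (Suc n)"] by auto
  then obtain \<beta> where \<beta>: "\<And>n. \<beta> n \<in> combos S"
      "\<And>n. rk_sqnorm S K (\<lambda>x. f x - kcomb K (\<beta> n) x) < 1 / real (Suc n)"
    by metis
  have "(\<lambda>n. rk_sqnorm S K (\<lambda>x. f x - kcomb K (\<beta> n) x)) \<longlonglongrightarrow> 0"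
  proof (rule tendsto_sandwich[OF _ _ tendsto_const])
    show "(\<lambda>n. 1 / real (Suc n)) \<longlonglongrightarrow> 0"
      using LIMSEQ_inverse_real_of_nat by (simp add: inverse_eq_divide)
  qed (use \<beta> rk_sqnorm_nonneg[OF rk_shift_le(1)[OF f]] in \<open>auto intro!: always_eventually less_imp_le\<close>)
  then show ?thesis
    using \<beta>(1) by (auto simp: approximates_def)
qed

lemma kform_diff_le:
  assumes f: "rk_bounded S K f" and v: "v \<in> combos S" and w: "w \<in> combos S"
  shows "kform K (v @ scale (-1) w) (v @ scale (-1) w)
    \<le> 2 * rk_sqnorm S K (\<lambda>x. f x - kcomb K v x) + 2 * rk_sqnorm S K (\<lambda>x. f x - kcomb K w x)"
proof -
  have "rk_sqnorm S K (kcomb K (v @ scale (-1) w)) = kform K (v @ scale (-1) w) (v @ scale (-1) w)"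
    using v w by (intro rk_kcomb) auto
  moreover have "kcomb K (v @ scale (-1) w) =
      (\<lambda>x. (f x - kcomb K w x) - (f x - kcomb K v x))"
    by auto
  ultimately show ?thesis
    using rk_diff(2)[OF rk_shift_le(1)[OF f w] rk_shift_le(1)[OF f v]] by simp
qed

lemma ev_diff_sq_le:
  assumes f: "rk_bounded S K f" and g: "rk_bounded S K g" and v: "v \<in> combos S" and w: "w \<in> combos S"
  shows "(ev g v - ev g w)\<^sup>2 \<le> rk_sqnorm S K g *
    (2 * rk_sqnorm S K (\<lambda>x. f x - kcomb K v x) + 2 * rk_sqnorm S K (\<lambda>x. f x - kcomb K w x))"
proof -
  have "(ev g (v @ scale (-1) w))\<^sup>2 \<le> rk_sqnorm S K g * kform K (v @ scale (-1) w) (v @ scale (-1) w)"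
    using v w by (intro ev_sq_le[OF g]) auto
  also have "\<dots> \<le> rk_sqnorm S K g *
    (2 * rk_sqnorm S K (\<lambda>x. f x - kcomb K v x) + 2 * rk_sqnorm S K (\<lambda>x. f x - kcomb K w x))"
    by (intro mult_left_mono kform_diff_le[OF f v w] rk_sqnorm_nonneg[OF g])
  finally show ?thesis by simp
qed

text \<open>
The inner product is forced on kernel combinations by the reproducing property,
\<open>\<langle>k\<^sub>v, g\<rangle> = ev g v\<close>, and extends to bounded \<open>f\<close> by continuity. The choice of the approximating sequence
does not matter, as \<open>rk_ip_limit\<close> shows.
\<close>

definition rk_ip :: "('a \<Rightarrow> real) \<Rightarrow> ('a \<Rightarrow> real) \<Rightarrow> real" where
  "rk_ip f g = lim (\<lambda>n. ev g ((SOME \<beta>. approximates \<beta> f) n))"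

lemma rk_ip_limit:
  assumes f: "rk_bounded S K f" and g: "rk_bounded S K g" and \<beta>: "approximates \<beta> f"
  shows "(\<lambda>n. ev g (\<beta> n)) \<longlonglongrightarrow> rk_ip f g"
proof -
  define \<gamma> where "\<gamma> = (SOME \<beta>. approximates \<beta> f)"
  define d where "d = (\<lambda>\<beta> (n :: nat). rk_sqnorm S K g * (2 * rk_sqnorm S K (\<lambda>x. f x - kcomb K (\<beta> n) x)))"
  have \<gamma>: "approximates \<gamma> f"
    unfolding \<gamma>_def using approximates_exists[OF f] by (rule someI_ex)
  have d0: "d \<beta> \<longlonglongrightarrow> 0" if "approximates \<beta> f" for \<beta>
    using that unfolding d_def approximates_def by (auto intro!: tendsto_eq_intros)
  have "Cauchy (\<lambda>n. ev g (\<gamma> n))"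
  proof (rule Cauchy_of_sq_dist_le[OF _ d0[OF \<gamma>]])
    fix m n show "(ev g (\<gamma> m) - ev g (\<gamma> n))\<^sup>2 \<le> d \<gamma> m + d \<gamma> n"
      using ev_diff_sq_le[OF f g, of "\<gamma> m" "\<gamma> n"] \<gamma> by (auto simp: approximates_def d_def algebra_simps)
  qed
  then have "(\<lambda>n. ev g (\<gamma> n)) \<longlonglongrightarrow> rk_ip f g"
    unfolding rk_ip_def \<gamma>_def[symmetric] by (simp add: Cauchy_convergent_iff convergent_LIMSEQ_iff)
  moreover have "(\<lambda>n. ev g (\<beta> n) - ev g (\<gamma> n)) \<longlonglongrightarrow> 0"
  proof (rule tendsto_zero_of_sq_le)
    fix n show "(ev g (\<beta> n) - ev g (\<gamma> n))\<^sup>2 \<le> d \<beta> n + d \<gamma> n"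
      using ev_diff_sq_le[OF f g, of "\<beta> n" "\<gamma> n"] \<beta> \<gamma> by (auto simp: approximates_def d_def algebra_simps)
    show "(\<lambda>n. d \<beta> n + d \<gamma> n) \<longlonglongrightarrow> 0"
      using tendsto_add[OF d0[OF \<beta>] d0[OF \<gamma>]] by simp
  qed
  ultimately show ?thesis
    using tendsto_add by fastforce
qed

lemma rk_ip_eqI:
  "rk_bounded S K f \<Longrightarrow> rk_bounded S K g \<Longrightarrow> approximates \<beta> f \<Longrightarrow> (\<lambda>n. ev g (\<beta> n)) \<longlonglongrightarrow> l
    \<Longrightarrow> rk_ip f g = l"
  using rk_ip_limit LIMSEQ_unique by blast

lemma rk_ip_cong:
  assumes f: "rk_bounded S K f" and g: "rk_bounded S K g"
    and "\<And>x. x \<in> S \<Longrightarrow> f x = f' x" "\<And>x. x \<in> S \<Longrightarrow> g x = g' x"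
  shows "rk_ip f g = rk_ip f' g'"
proof -
  have f': "rk_bounded S K f'" and g': "rk_bounded S K g'"
    using f g rk_cong(1)[of S f f' K] rk_cong(1)[of S g g' K] assms by auto
  obtain \<beta> where \<beta>: "approximates \<beta> f'"
    using approximates_exists[OF f'] by blast
  have eq: "rk_sqnorm S K (\<lambda>x. f x - kcomb K v x) = rk_sqnorm S K (\<lambda>x. f' x - kcomb K v x)" for v
    using assms by (intro rk_cong) auto
  have "ev g (\<beta> n) = ev g' (\<beta> n)" for n
    using \<beta> assms(4) by (intro ev_cong[of _ S]) (auto simp: approximates_def)
  then show ?thesis
    using rk_ip_limit[OF f' g' \<beta>] \<beta> by (intro rk_ip_eqI[OF f g, of \<beta>]) (auto simp: approximates_def eq)
qed

lemma rk_ip_add_right: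
  assumes f: "rk_bounded S K f" and g: "rk_bounded S K g" and h: "rk_bounded S K h"
  shows "rk_ip f (\<lambda>x. g x + h x) = rk_ip f g + rk_ip f h"
proof -
  obtain \<beta> where \<beta>: "approximates \<beta> f" using approximates_exists[OF f] by blast
  show ?thesis
    using tendsto_add[OF rk_ip_limit[OF f g \<beta>] rk_ip_limit[OF f h \<beta>]]
    by (intro rk_ip_eqI[OF f rk_add(1)[OF g h] \<beta>]) (simp add: ev_add)
qed

lemma rk_ip_cmult_right:
  assumes f: "rk_bounded S K f" and g: "rk_bounded S K g"
  shows "rk_ip f (\<lambda>x. c * g x) = c * rk_ip f g"
proof -
  obtain \<beta> where \<beta>: "approximates \<beta> f" using approximates_exists[OF f] by blast
  show ?thesis
    using tendsto_mult[OF tendsto_const rk_ip_limit[OF f g \<beta>], of c]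
    by (intro rk_ip_eqI[OF f rk_cmult(1)[OF g] \<beta>]) (simp add: ev_cmult)
qed

lemma kform_approximants:
  assumes f: "rk_bounded S K f" and \<beta>: "approximates \<beta> f"
  shows "(\<lambda>n. 2 * ev f (\<beta> n) - kform K (\<beta> n) (\<beta> n)) \<longlonglongrightarrow> rk_sqnorm S K f"
proof -
  have "2 * ev f (\<beta> n) - kform K (\<beta> n) (\<beta> n) =
      rk_sqnorm S K f - rk_sqnorm S K (\<lambda>x. f x - kcomb K (\<beta> n) x)" for n
    using rk_shift[OF f, of "\<beta> n"] \<beta> by (simp add: approximates_def)
  then show ?thesis
    using \<beta> by (auto simp: approximates_def intro!: tendsto_eq_intros)
qed

text \<open>
This symmetric expression for the inner product is what makes symmetry visible; the definition treats
its two arguments differently.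
\<close>

lemma kform_limit:
  assumes f: "rk_bounded S K f" and \<beta>: "approximates \<beta> f"
    and g: "rk_bounded S K g" and \<gamma>: "approximates \<gamma> g"
  shows "(\<lambda>n. kform K (\<beta> n) (\<gamma> n)) \<longlonglongrightarrow> rk_ip f g"
proof -
  let ?N = "\<lambda>n. rk_sqnorm S K (\<lambda>x. g x - kcomb K (\<gamma> n) x) * kform K (\<beta> n) (\<beta> n)"
  have \<beta>S: "\<beta> n \<in> combos S" and \<gamma>S: "\<gamma> n \<in> combos S" for n
    using \<beta> \<gamma> by (auto simp: approximates_def)
  have "(\<lambda>n. 2 * ev f (\<beta> n) - (2 * ev f (\<beta> n) - kform K (\<beta> n) (\<beta> n)))
      \<longlonglongrightarrow> 2 * rk_ip f f - rk_sqnorm S K f"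
    by (intro tendsto_diff tendsto_mult tendsto_const rk_ip_limit[OF f f \<beta>] kform_approximants[OF f \<beta>])
  then have "?N \<longlonglongrightarrow> 0 * (2 * rk_ip f f - rk_sqnorm S K f)"
    using \<gamma> by (intro tendsto_mult) (auto simp: approximates_def)
  then have N0: "?N \<longlonglongrightarrow> 0" by simp
  have "(\<lambda>n. ev g (\<beta> n) - kform K (\<beta> n) (\<gamma> n)) \<longlonglongrightarrow> 0"
  proof (rule tendsto_zero_of_sq_le[OF _ N0])
    fix n
    have "(ev (\<lambda>x. g x - kcomb K (\<gamma> n) x) (\<beta> n))\<^sup>2 \<le> ?N n"
      by (intro ev_sq_le rk_shift_le(1) g \<beta>S \<gamma>S)
    moreover have "ev (\<lambda>x. g x - kcomb K (\<gamma> n) x) (\<beta> n) = ev g (\<beta> n) - kform K (\<beta> n) (\<gamma> n)"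
      using kform_sym[OF \<beta>S \<gamma>S] by (simp add: ev_diff ev_kcomb)
    ultimately show "(ev g (\<beta> n) - kform K (\<beta> n) (\<gamma> n))\<^sup>2 \<le> ?N n" by simp
  qed
  from tendsto_diff[OF rk_ip_limit[OF f g \<beta>] this] show ?thesis by simp
qed

lemma rk_ip_sym:
  assumes f: "rk_bounded S K f" and g: "rk_bounded S K g"
  shows "rk_ip f g = rk_ip g f"
proof -
  obtain \<beta> \<gamma> where \<beta>: "approximates \<beta> f" and \<gamma>: "approximates \<gamma> g"
    using approximates_exists f g by meson
  have "kform K (\<beta> n) (\<gamma> n) = kform K (\<gamma> n) (\<beta> n)" for n
    using \<beta> \<gamma> by (intro kform_sym) (auto simp: approximates_def)
  then show ?thesis
    using kform_limit[OF f \<beta> g \<gamma>] kform_limit[OF g \<gamma> f \<beta>] LIMSEQ_unique by simp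
qed

lemma rk_ip_self:
  assumes f: "rk_bounded S K f"
  shows "rk_ip f f = rk_sqnorm S K f"
proof -
  obtain \<beta> where \<beta>: "approximates \<beta> f" using approximates_exists[OF f] by blast
  have "(\<lambda>n. 2 * ev f (\<beta> n) - kform K (\<beta> n) (\<beta> n)) \<longlonglongrightarrow> 2 * rk_ip f f - rk_ip f f"
    by (intro tendsto_diff tendsto_mult tendsto_const rk_ip_limit[OF f f \<beta>] kform_limit f \<beta>)
  then show ?thesis
    using kform_approximants[OF f \<beta>] LIMSEQ_unique by fastforce
qed

lemma rk_ip_kcomb_left:
  assumes v: "v \<in> combos S" and g: "rk_bounded S K g"
  shows "rk_ip (kcomb K v) g = ev g v"
  by (rule rk_ip_eqI[OF rk_kcomb(1)[OF v] g, of "\<lambda>n. v"]) (auto simp: approximates_def v rk_zero)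

lemma rk_ip_add_left:
  assumes f: "rk_bounded S K f" and g: "rk_bounded S K g" and h: "rk_bounded S K h"
  shows "rk_ip (\<lambda>x. f x + g x) h = rk_ip f h + rk_ip g h"
  using rk_ip_add_right[OF h f g]
  by (simp add: rk_ip_sym[OF h f] rk_ip_sym[OF h g] rk_ip_sym[OF h rk_add(1)[OF f g]])

lemma rk_ip_cmult_left:
  assumes f: "rk_bounded S K f" and g: "rk_bounded S K g"
  shows "rk_ip (\<lambda>x. c * f x) g = c * rk_ip f g"
  using rk_ip_cmult_right[OF g f]
  by (simp add: rk_ip_sym[OF g f] rk_ip_sym[OF g rk_cmult(1)[OF f]])

lemma rk_ip_diff_left:
  assumes f: "rk_bounded S K f" and g: "rk_bounded S K g" and h: "rk_bounded S K h"
  shows "rk_ip (\<lambda>x. f x - g x) h = rk_ip f h - rk_ip g h"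
  using rk_ip_add_left[OF f rk_cmult(1)[OF g, of "-1"] h] rk_ip_cmult_left[OF g h, of "-1"] by simp

lemma rk_ip_Cauchy_Schwarz:
  assumes f: "rk_bounded S K f" and g: "rk_bounded S K g"
  shows "(rk_ip f g)\<^sup>2 \<le> rk_sqnorm S K f * rk_sqnorm S K g"
proof (rule sq_le_of_quadratic_bound)
  fix c :: real
  let ?h = "\<lambda>x. f x - c * g x"
  have cg: "rk_bounded S K (\<lambda>x. c * g x)" by (rule rk_cmult(1)[OF g])
  have h: "rk_bounded S K ?h" by (rule rk_diff(1)[OF f cg])
  have "rk_ip ?h ?h = rk_ip f ?h - c * rk_ip g ?h"
    using rk_ip_diff_left[OF f cg h] rk_ip_cmult_left[OF g h] by simp
  also have "rk_ip f ?h = rk_ip f f - c * rk_ip f g"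
    using rk_ip_diff_left[OF f cg f] rk_ip_cmult_left[OF g f] rk_ip_sym[OF f h] rk_ip_sym[OF f g] by simp
  also have "rk_ip g ?h = rk_ip f g - c * rk_ip g g"
    using rk_ip_diff_left[OF f cg g] rk_ip_cmult_left[OF g g] rk_ip_sym[OF g h] by simp
  finally have "rk_sqnorm S K ?h = rk_sqnorm S K f - 2 * c * rk_ip f g + c\<^sup>2 * rk_sqnorm S K g"
    using rk_ip_self f g h by (simp add: power2_eq_square algebra_simps)
  then show "2 * c * rk_ip f g - c\<^sup>2 * rk_sqnorm S K g \<le> rk_sqnorm S K f"
    using rk_sqnorm_nonneg[OF h] by simp
qed (rule rk_sqnorm_nonneg[OF g])

end

section \<open>Existence and uniqueness of the reproducing kernel Hilbert space\<close>

text \<open>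
The next lemmas carry the elementary geometry of an inner product over to an arbitrary Hilbert space of
functions on \<open>S\<close>. They are stated for \<open>f + c g\<close>, which covers sums, differences and multiples together.
\<close>

lemma hilbert_function_space_lincomb:
  assumes hs: "hilbert_function_space S H ip" and f: "f \<in> H" and g: "g \<in> H"
  shows "(\<lambda>x\<in>S. f x + c * g x) \<in> H"
    "h \<in> H \<Longrightarrow> ip ((\<lambda>x\<in>S. f x + c * g x), h) = ip (f, h) + c * ip (g, h)"
    "h \<in> H \<Longrightarrow> ip (h, (\<lambda>x\<in>S. f x + c * g x)) = ip (h, f) + c * ip (h, g)"
proof -
  have cg: "(\<lambda>x\<in>S. c * g x) \<in> H"
    using hs g unfolding hilbert_function_space_def by blast
  have eq: "(\<lambda>x\<in>S. f x + c * g x) = (\<lambda>x\<in>S. f x + (\<lambda>x\<in>S. c * g x) x)"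
    by (intro restrict_ext) simp
  show mem: "(\<lambda>x\<in>S. f x + c * g x) \<in> H"
    unfolding eq using hs f cg unfolding hilbert_function_space_def by blast
  have lin: "ip ((\<lambda>x\<in>S. f x + c * g x), h) = ip (f, h) + c * ip (g, h)" if "h \<in> H" for h
  proof -
    have "ip ((\<lambda>x\<in>S. f x + (\<lambda>x\<in>S. c * g x) x), h) = ip (f, h) + ip ((\<lambda>x\<in>S. c * g x), h)"
      using hs f cg that unfolding hilbert_function_space_def by blast
    also have "ip ((\<lambda>x\<in>S. c * g x), h) = c * ip (g, h)"
      using hs g that unfolding hilbert_function_space_def by blast
    finally show ?thesis unfolding eq .
  qed
  then show "h \<in> H \<Longrightarrow> ip ((\<lambda>x\<in>S. f x + c * g x), h) = ip (f, h) + c * ip (g, h)" .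
  have sym: "ip (a, b) = ip (b, a)" if "a \<in> H" "b \<in> H" for a b
    using hs that unfolding hilbert_function_space_def by blast
  show "h \<in> H \<Longrightarrow> ip (h, (\<lambda>x\<in>S. f x + c * g x)) = ip (h, f) + c * ip (h, g)"
    using lin[of h] sym[OF _ mem, of h] sym[OF _ f, of h] sym[OF _ g, of h] by simp
qed

lemma hilbert_function_space_sq:
  assumes hs: "hilbert_function_space S H ip" and f: "f \<in> H" and g: "g \<in> H"
  shows "ip ((\<lambda>x\<in>S. f x + c * g x), (\<lambda>x\<in>S. f x + c * g x))
      = ip (f, f) + 2 * c * ip (f, g) + c\<^sup>2 * ip (g, g)"
    "ip (f, f) + 2 * c * ip (f, g) + c\<^sup>2 * ip (g, g) \<ge> 0"
proof -
  note L = hilbert_function_space_lincomb[OF hs f g, where c = c]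
  have "ip (g, f) = ip (f, g)"
    using hs f g unfolding hilbert_function_space_def by blast
  then show eq: "ip ((\<lambda>x\<in>S. f x + c * g x), (\<lambda>x\<in>S. f x + c * g x))
      = ip (f, f) + 2 * c * ip (f, g) + c\<^sup>2 * ip (g, g)"
    unfolding L(2)[OF L(1)] L(3)[OF f] L(3)[OF g] by (simp add: power2_eq_square algebra_simps)
  have "ip ((\<lambda>x\<in>S. f x + c * g x), (\<lambda>x\<in>S. f x + c * g x)) \<ge> 0"
    using hs L(1) unfolding hilbert_function_space_def by blast
  then show "ip (f, f) + 2 * c * ip (f, g) + c\<^sup>2 * ip (g, g) \<ge> 0"
    unfolding eq .
qed

lemma hilbert_function_space_Cauchy_Schwarz:
  assumes hs: "hilbert_function_space S H ip" and f: "f \<in> H" and g: "g \<in> H"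
  shows "(ip (f, g))\<^sup>2 \<le> ip (f, f) * ip (g, g)"
proof (rule sq_le_of_quadratic_bound)
  show "ip (g, g) \<ge> 0" using hs g unfolding hilbert_function_space_def by blast
  show "2 * c * ip (f, g) - c\<^sup>2 * ip (g, g) \<le> ip (f, f)" for c
    using hilbert_function_space_sq(2)[OF hs f g, of "-c"] by simp
qed

lemma hilbert_function_space_complete:
  assumes hs: "hilbert_function_space S H ip" and \<sigma>: "\<And>n. \<sigma> n \<in> H"
    and cauchy: "\<And>\<epsilon>. \<epsilon> > 0 \<Longrightarrow> \<exists>N. \<forall>m\<ge>N. \<forall>n\<ge>N.
      sqrt (ip ((\<lambda>x\<in>S. \<sigma> m x - \<sigma> n x), (\<lambda>x\<in>S. \<sigma> m x - \<sigma> n x))) < \<epsilon>"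
  shows "\<exists>f\<in>H. (\<lambda>n. sqrt (ip ((\<lambda>x\<in>S. \<sigma> n x - f x), (\<lambda>x\<in>S. \<sigma> n x - f x)))) \<longlonglongrightarrow> 0"
proof -
  \<comment> \<open>Completeness is the last conjunct of the definition.\<close>
  note c = hs[unfolded hilbert_function_space_def Let_def, THEN conjunct2, THEN conjunct2,
      THEN conjunct2, THEN conjunct2, THEN conjunct2, THEN conjunct2, THEN conjunct2,
      THEN conjunct2, THEN conjunct2, THEN conjunct2]
  show ?thesis
    by (rule c[rule_format]) (intro conjI allI impI \<sigma> cauchy)
qed

context positive_kernel
begin

definition rk_space :: "('a \<Rightarrow> real) set" where
  "rk_space = {f \<in> S \<rightarrow>\<^sub>E UNIV. rk_bounded S K f}"

definition rk_inner :: "('a \<Rightarrow> real) \<times> ('a \<Rightarrow> real) \<Rightarrow> real" where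
  "rk_inner = (\<lambda>(f, g)\<in>rk_space \<times> rk_space. rk_ip f g)"

lemma restrict_in_rk_space: "rk_bounded S K f \<Longrightarrow> restrict f S \<in> rk_space"
  using rk_cong(1)[of S "restrict f S" f K] by (simp add: rk_space_def)

lemma rk_inner_restrict:
  assumes "rk_bounded S K f" "rk_bounded S K g"
  shows "rk_inner (restrict f S, restrict g S) = rk_ip f g"
proof -
  have "rk_inner (restrict f S, restrict g S) = rk_ip (restrict f S) (restrict g S)"
    using assms by (simp add: rk_inner_def restrict_in_rk_space)
  also have "\<dots> = rk_ip f g"
    using assms by (intro rk_ip_cong[symmetric]) auto
  finally show ?thesis .
qed

lemma rk_eval_sq_le:
  assumes f: "rk_bounded S K f" and t: "t \<in> S"
  shows "(f t)\<^sup>2 \<le> rk_sqnorm S K f * K (t, t)"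
  using ev_sq_le[OF f, of "[(t, 1)]"] t by (simp add: kform_def)

lemma kernel_diag_nonneg: "t \<in> S \<Longrightarrow> K (t, t) \<ge> 0"
  using kform_nonneg[of "[(t, 1)]"] by (simp add: kform_def)

text \<open>
Norm convergence controls the values at points, so a Cauchy sequence has a pointwise limit \<open>f\<close>. Each
quantity \<open>2 * ev (\<sigma> n - f) v - kform K v v\<close> is a limit over \<open>m\<close> of the same quantity for \<open>\<sigma> n - \<sigma> m\<close>, so the
Cauchy bound passes to the supremum.
\<close>

lemma rk_complete:
  assumes \<sigma>: "\<And>n. rk_bounded S K (\<sigma> n)"
    and cauchy: "\<And>\<epsilon>. \<epsilon> > 0 \<Longrightarrow> \<exists>N. \<forall>m\<ge>N. \<forall>n\<ge>N. sqrt (rk_sqnorm S K (\<lambda>x. \<sigma> m x - \<sigma> n x)) < \<epsilon>"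
  shows "\<exists>f. rk_bounded S K f \<and> (\<lambda>n. sqrt (rk_sqnorm S K (\<lambda>x. \<sigma> n x - f x))) \<longlonglongrightarrow> 0"
proof -
  have "convergent (\<lambda>n. \<sigma> n t)" if t: "t \<in> S" for t
  proof -
    have "Cauchy (\<lambda>n. \<sigma> n t)"
    proof (rule CauchyI)
      fix r :: real assume "r > 0"
      \<comment> \<open>Any positive upper bound for \<open>sqrt (K (t, t))\<close> serves; adding 1 keeps it from vanishing.\<close>
      define k where "k = sqrt (K (t, t) + 1)"
      have k: "k > 0" using kernel_diag_nonneg[OF t] by (simp add: k_def)
      obtain N where N: "\<And>m n. m \<ge> N \<Longrightarrow> n \<ge> N \<Longrightarrow> sqrt (rk_sqnorm S K (\<lambda>x. \<sigma> m x - \<sigma> n x)) < r / k"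
        using cauchy[of "r / k"] \<open>r > 0\<close> k by auto
      have "norm (\<sigma> m t - \<sigma> n t) < r" if "m \<ge> N" "n \<ge> N" for m n
      proof -
        let ?q = "rk_sqnorm S K (\<lambda>x. \<sigma> m x - \<sigma> n x)"
        have b: "rk_bounded S K (\<lambda>x. \<sigma> m x - \<sigma> n x)" by (intro rk_diff \<sigma>)
        have "(\<sigma> m t - \<sigma> n t)\<^sup>2 \<le> ?q * K (t, t)"
          by (rule rk_eval_sq_le[OF b t])
        also have "\<dots> \<le> ?q * (K (t, t) + 1)"
          using rk_sqnorm_nonneg[OF b] by (intro mult_left_mono) auto
        finally have "sqrt ((\<sigma> m t - \<sigma> n t)\<^sup>2) \<le> sqrt (?q * (K (t, t) + 1))"
          by (rule real_sqrt_le_mono)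
        then have "\<bar>\<sigma> m t - \<sigma> n t\<bar> \<le> sqrt ?q * k"
          by (simp add: real_sqrt_mult k_def)
        also have "\<dots> < (r / k) * k"
          using N[OF that] k by (intro mult_strict_right_mono)
        finally show ?thesis using k by simp
      qed
      then show "\<exists>M. \<forall>m\<ge>M. \<forall>n\<ge>M. norm (\<sigma> m t - \<sigma> n t) < r" by auto
    qed
    then show ?thesis by (simp add: Cauchy_convergent_iff)
  qed
  then have lim: "(\<lambda>n. \<sigma> n t) \<longlonglongrightarrow> lim (\<lambda>n. \<sigma> n t)" if "t \<in> S" for t
    using that by (simp add: convergent_LIMSEQ_iff)
  define f where "f = (\<lambda>t. lim (\<lambda>n. \<sigma> n t))"
  have diff: "rk_bounded S K (\<lambda>x. \<sigma> n x - f x) \<and> rk_sqnorm S K (\<lambda>x. \<sigma> n x - f x) \<le> \<epsilon>\<^sup>2"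
    if N: "\<And>m n. m \<ge> N \<Longrightarrow> n \<ge> N \<Longrightarrow> sqrt (rk_sqnorm S K (\<lambda>x. \<sigma> m x - \<sigma> n x)) < \<epsilon>"
      and n: "n \<ge> N" for N n \<epsilon>
  proof -
    have "2 * ev (\<lambda>x. \<sigma> n x - f x) v - kform K v v \<le> \<epsilon>\<^sup>2" if v: "v \<in> combos S" for v
    proof (rule LIMSEQ_le_const2)
      have "(\<lambda>m. ev (\<sigma> m) v) \<longlonglongrightarrow> ev f v"
        by (rule tendsto_ev[OF _ v]) (auto simp: f_def lim)
      then show "(\<lambda>m. 2 * ev (\<lambda>x. \<sigma> n x - \<sigma> m x) v - kform K v v)
          \<longlonglongrightarrow> 2 * ev (\<lambda>x. \<sigma> n x - f x) v - kform K v v"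
        unfolding ev_diff by (intro tendsto_intros)
      have "2 * ev (\<lambda>x. \<sigma> n x - \<sigma> m x) v - kform K v v \<le> \<epsilon>\<^sup>2" if m: "m \<ge> N" for m
      proof -
        have b: "rk_bounded S K (\<lambda>x. \<sigma> n x - \<sigma> m x)" by (intro rk_diff \<sigma>)
        have "(sqrt (rk_sqnorm S K (\<lambda>x. \<sigma> n x - \<sigma> m x)))\<^sup>2 \<le> \<epsilon>\<^sup>2"
          using N[OF n m] rk_sqnorm_nonneg[OF b] by (intro power_mono) auto
        then show ?thesis
          using rk_upper[OF b v] rk_sqnorm_nonneg[OF b] by simp
      qed
      then show "\<exists>M. \<forall>m\<ge>M. 2 * ev (\<lambda>x. \<sigma> n x - \<sigma> m x) v - kform K v v \<le> \<epsilon>\<^sup>2" by blast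
    qed
    then show ?thesis by (auto intro: rk_least)
  qed
  have f_bounded: "rk_bounded S K f"
  proof -
    obtain N where N: "\<And>m n. m \<ge> N \<Longrightarrow> n \<ge> N \<Longrightarrow> sqrt (rk_sqnorm S K (\<lambda>x. \<sigma> m x - \<sigma> n x)) < 1"
      using cauchy[of 1] by auto
    have "rk_bounded S K (\<lambda>x. \<sigma> N x - (\<sigma> N x - f x))"
      using diff[of N 1 N] N by (intro rk_diff(1)[OF \<sigma>, of "\<lambda>x. \<sigma> N x - f x"]) auto
    then show ?thesis by simp
  qed
  moreover have "(\<lambda>n. sqrt (rk_sqnorm S K (\<lambda>x. \<sigma> n x - f x))) \<longlonglongrightarrow> 0"
  proof (rule LIMSEQ_I)
    fix r :: real assume "r > 0"
    then obtain N where N: "\<And>m n. m \<ge> N \<Longrightarrow> n \<ge> N \<Longrightarrow> sqrt (rk_sqnorm S K (\<lambda>x. \<sigma> m x - \<sigma> n x)) < r / 2"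
      using cauchy[of "r / 2"] by auto
    have "norm (sqrt (rk_sqnorm S K (\<lambda>x. \<sigma> n x - f x)) - 0) < r" if n: "n \<ge> N" for n
    proof -
      have d: "rk_bounded S K (\<lambda>x. \<sigma> n x - f x)" "rk_sqnorm S K (\<lambda>x. \<sigma> n x - f x) \<le> (r / 2)\<^sup>2"
        using diff[of N "r / 2" n] N n by auto
      have "sqrt (rk_sqnorm S K (\<lambda>x. \<sigma> n x - f x)) \<le> r / 2"
        using real_sqrt_le_mono[OF d(2)] \<open>r > 0\<close> by simp
      then show ?thesis using rk_sqnorm_nonneg[OF d(1)] \<open>r > 0\<close> by simp
    qed
    then show "\<exists>N. \<forall>n\<ge>N. norm (sqrt (rk_sqnorm S K (\<lambda>x. \<sigma> n x - f x)) - 0) < r" by blast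
  qed
  ultimately show ?thesis by blast
qed

lemma is_rkhs_rk_space: "is_rkhs S K rk_space rk_inner"
proof -
  have mem: "f \<in> rk_space \<Longrightarrow> rk_bounded S K f"
    and ext: "f \<in> rk_space \<Longrightarrow> restrict f S = f" for f
    by (auto simp: rk_space_def PiE_restrict)
  have inner: "rk_inner (f, g) = rk_ip f g" if "f \<in> rk_space" "g \<in> rk_space" for f g
    using that by (simp add: rk_inner_def)
  have inner_l: "rk_inner (restrict f S, g) = rk_ip f g" if "rk_bounded S K f" "g \<in> rk_space" for f g
    using rk_inner_restrict[OF that(1) mem[OF that(2)]] ext[OF that(2)] by simp
  have dist: "rk_inner ((\<lambda>x\<in>S. f x - g x), (\<lambda>x\<in>S. f x - g x)) = rk_sqnorm S K (\<lambda>x. f x - g x)"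
    if "f \<in> rk_space" "g \<in> rk_space" for f g
    using that by (simp add: rk_inner_restrict rk_ip_self rk_diff(1) mem)
  have complete: "\<exists>f\<in>rk_space. (\<lambda>n. sqrt (rk_inner ((\<lambda>x\<in>S. \<sigma> n x - f x), (\<lambda>x\<in>S. \<sigma> n x - f x)))) \<longlonglongrightarrow> 0"
    if \<sigma>: "\<forall>n. \<sigma> n \<in> rk_space" and cauchy: "\<forall>\<epsilon>>0. \<exists>N. \<forall>m\<ge>N. \<forall>n\<ge>N.
      sqrt (rk_inner ((\<lambda>x\<in>S. \<sigma> m x - \<sigma> n x), (\<lambda>x\<in>S. \<sigma> m x - \<sigma> n x))) < \<epsilon>" for \<sigma>
  proof -
    obtain f where f: "rk_bounded S K f" "(\<lambda>n. sqrt (rk_sqnorm S K (\<lambda>x. \<sigma> n x - f x))) \<longlonglongrightarrow> 0"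
      using rk_complete[of \<sigma>] \<sigma> cauchy mem by (auto simp: dist)
    have "rk_sqnorm S K (\<lambda>x. \<sigma> n x - restrict f S x) = rk_sqnorm S K (\<lambda>x. \<sigma> n x - f x)" for n
      by (rule rk_cong) simp
    then show ?thesis
      using f \<sigma> restrict_in_rk_space[OF f(1)]
      by (intro bexI[of _ "restrict f S"]) (simp_all add: dist del: restrict_apply)
  qed
  have zero: "f = (\<lambda>x\<in>S. 0)" if f: "f \<in> rk_space" and "rk_inner (f, f) = 0" for f
  proof -
    have "rk_sqnorm S K f = 0" using that by (simp add: inner rk_ip_self mem)
    then have "f x = 0" if "x \<in> S" for x
      using rk_eval_sq_le[OF mem[OF f] that] by simp
    then have "restrict f S = (\<lambda>x\<in>S. 0)" by (intro restrict_ext) auto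
    then show ?thesis using ext[OF f] by simp
  qed
  have "hilbert_function_space S rk_space rk_inner"
    unfolding hilbert_function_space_def Let_def
  proof (intro conjI ballI allI impI)
    show "rk_inner \<in> rk_space \<times> rk_space \<rightarrow>\<^sub>E UNIV"
      by (auto simp: rk_inner_def)
  next
    fix f g assume "f \<in> rk_space" "g \<in> rk_space"
    then show "rk_inner (f, g) = rk_inner (g, f)"
      by (simp add: inner rk_ip_sym mem)
  next
    fix f g h assume "f \<in> rk_space" "g \<in> rk_space" "h \<in> rk_space"
    then show "rk_inner ((\<lambda>x\<in>S. f x + g x), h) = rk_inner (f, h) + rk_inner (g, h)"
      by (simp add: inner inner_l rk_ip_add_left rk_add(1) mem)
  next
    fix c f h assume "f \<in> rk_space" "h \<in> rk_space"
    then show "rk_inner ((\<lambda>x\<in>S. c * f x), h) = c * rk_inner (f, h)"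
      by (simp add: inner inner_l rk_ip_cmult_left rk_cmult(1) mem)
  next
    fix f assume "f \<in> rk_space"
    then show "rk_inner (f, f) \<ge> 0"
      by (simp add: inner rk_ip_self mem rk_sqnorm_nonneg)
  next
    fix \<sigma> :: "nat \<Rightarrow> 'a \<Rightarrow> real"
    assume "(\<forall>n. \<sigma> n \<in> rk_space) \<and> (\<forall>\<epsilon>>0. \<exists>N. \<forall>m\<ge>N. \<forall>n\<ge>N.
      sqrt (rk_inner ((\<lambda>x\<in>S. \<sigma> m x - \<sigma> n x), (\<lambda>x\<in>S. \<sigma> m x - \<sigma> n x))) < \<epsilon>)"
    then show "\<exists>f\<in>rk_space. (\<lambda>n. sqrt (rk_inner ((\<lambda>x\<in>S. \<sigma> n x - f x), (\<lambda>x\<in>S. \<sigma> n x - f x)))) \<longlonglongrightarrow> 0"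
      using complete by blast
  next
    fix f g assume "f \<in> rk_space" "g \<in> rk_space"
    then show "(\<lambda>x\<in>S. f x + g x) \<in> rk_space"
      by (intro restrict_in_rk_space rk_add(1) mem)
  next
    fix c f assume "f \<in> rk_space"
    then show "(\<lambda>x\<in>S. c * f x) \<in> rk_space"
      by (intro restrict_in_rk_space rk_cmult(1) mem)
  next
    show "(\<lambda>x\<in>S. 0) \<in> rk_space"
      by (rule restrict_in_rk_space[OF rk_zero(1)])
  next
    show "rk_space \<subseteq> S \<rightarrow>\<^sub>E UNIV" by (auto simp: rk_space_def)
  qed (rule zero)
  moreover have "(\<lambda>s\<in>S. K (t, s)) \<in> rk_space" "f \<in> rk_space \<Longrightarrow> rk_inner (f, (\<lambda>s\<in>S. K (t, s))) = f t"
    if t: "t \<in> S" for t f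
  proof -
    have v: "[(t, 1)] \<in> combos S" and eq: "kcomb K [(t, 1)] = (\<lambda>s. K (t, s))"
      using t by auto
    have b: "rk_bounded S K (\<lambda>s. K (t, s))"
      using rk_kcomb(1)[OF v] unfolding eq .
    then show "(\<lambda>s\<in>S. K (t, s)) \<in> rk_space" by (rule restrict_in_rk_space)
    assume f: "f \<in> rk_space"
    have "rk_inner (f, (\<lambda>s\<in>S. K (t, s))) = rk_ip f (\<lambda>s. K (t, s))"
      using rk_inner_restrict[OF mem[OF f] b] ext[OF f] by simp
    also have "\<dots> = f t"
      using rk_ip_kcomb_left[OF v mem[OF f]] rk_ip_sym[OF mem[OF f] b] unfolding eq by simp
    finally show "rk_inner (f, (\<lambda>s\<in>S. K (t, s))) = f t" .
  qed
  ultimately show ?thesis unfolding is_rkhs_def by blast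
qed

text \<open>
For \<open>f\<close> in any reproducing kernel Hilbert space \<open>H\<close>, expanding \<open>\<parallel>f - k\<^sub>v\<parallel>\<^sup>2 \<ge> 0\<close> gives that \<open>f\<close> is bounded.
Conversely, for a bounded \<open>f\<close> take kernel combinations approximating it in the dual norm. They form
a Cauchy sequence in \<open>H\<close> as well, because the norms of their differences are determined by \<open>K\<close>; its
limit in \<open>H\<close> has the same values as \<open>f\<close>. The inner product is determined by the same approximation.
\<close>

lemma is_rkhs_unique:
  assumes rkhs: "is_rkhs S K H ip"
  shows "H = rk_space" "ip = rk_inner"
proof -
  have hs: "hilbert_function_space S H ip" using rkhs by (simp add: is_rkhs_def)
  have ext: "restrict f S = f" if "f \<in> H" for f
    using hs that unfolding hilbert_function_space_def by (meson PiE_restrict subsetD)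
  have zero: "(\<lambda>x\<in>S. 0) \<in> H" and sym: "f \<in> H \<Longrightarrow> g \<in> H \<Longrightarrow> ip (f, g) = ip (g, f)" for f g
    using hs unfolding hilbert_function_space_def by blast+
  have cmult0: "ip ((\<lambda>x\<in>S. 0 * f x), g) = 0 * ip (f, g)" if "f \<in> H" "g \<in> H" for f g
    using hs that unfolding hilbert_function_space_def by blast
  define k where "k = (\<lambda>v. restrict (kcomb K v) S)"
  have k: "k v \<in> H \<and> (\<forall>f\<in>H. ip (f, k v) = ev f v)" if "v \<in> combos S" for v
    using that
  proof (induction v)
    case Nil
    have k0: "k [] = (\<lambda>x\<in>S. 0)" unfolding k_def by (intro restrict_ext) simp
    have "ip (f, k []) = 0" if "f \<in> H" for f
      using cmult0[OF that that] sym[OF that zero] by (simp add: k0)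
    then show ?case using zero unfolding k0 ev_simps by blast
  next
    case (Cons p v)
    obtain s a where p: "p = (s, a)" by fastforce
    have s: "s \<in> S" and v: "v \<in> combos S" using Cons.prems p by auto
    have ks: "(\<lambda>t\<in>S. K (s, t)) \<in> H" "\<And>f. f \<in> H \<Longrightarrow> ip (f, (\<lambda>t\<in>S. K (s, t))) = f s"
      using rkhs s by (auto simp: is_rkhs_def)
    have eq: "k (p # v) = (\<lambda>x\<in>S. k v x + a * (\<lambda>t\<in>S. K (s, t)) x)"
      unfolding k_def p by (intro restrict_ext) simp
    have kv: "k v \<in> H" "\<And>f. f \<in> H \<Longrightarrow> ip (f, k v) = ev f v"
      using Cons.IH[OF v] by auto
    note L = hilbert_function_space_lincomb[OF hs kv(1) ks(1), where c = a, folded eq]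
    show ?case
      using L(1) L(3) kv(2) ks(2) by (simp add: p)
  qed
  have kk: "ip (k v, k v) = kform K v v" if "v \<in> combos S" for v
  proof -
    have "ip (k v, k v) = ev (k v) v" using k that by blast
    also have "\<dots> = kform K v v"
      unfolding kform_def k_def using that by (intro ev_cong) auto
    finally show ?thesis .
  qed
  have bounded: "rk_bounded S K f" if f: "f \<in> H" for f
  proof (rule rk_least)
    fix v :: "('a \<times> real) list" assume v: "v \<in> combos S"
    show "2 * ev f v - kform K v v \<le> ip (f, f)"
      using hilbert_function_space_sq(2)[OF hs f, of "k v" "-1"] k[OF v] f kk[OF v] by simp
  qed
  have main: "f \<in> H \<and> (\<forall>h\<in>H. ip (f, h) = rk_ip f h)" if f: "f \<in> rk_space" for f
  proof -
    have fb: "rk_bounded S K f" using f by (simp add: rk_space_def)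
    obtain \<beta> where \<beta>: "approximates \<beta> f" using approximates_exists[OF fb] by blast
    then have \<beta>S: "\<beta> n \<in> combos S" for n by (simp add: approximates_def)
    let ?e = "\<lambda>n. rk_sqnorm S K (\<lambda>x. f x - kcomb K (\<beta> n) x)"
    have e0: "?e \<longlonglongrightarrow> 0" using \<beta> by (simp add: approximates_def)
    let ?d = "\<lambda>f g. (\<lambda>x\<in>S. f x - g x)"
    have close: "ip (?d (k (\<beta> m)) (k (\<beta> n)), ?d (k (\<beta> m)) (k (\<beta> n))) \<le> 2 * ?e m + 2 * ?e n" for m n
    proof -
      have "?d (k (\<beta> m)) (k (\<beta> n)) = k (\<beta> m @ scale (-1) (\<beta> n))"
        unfolding k_def by (intro restrict_ext) simp
      then show ?thesis
        using kk[of "\<beta> m @ scale (-1) (\<beta> n)"] kform_diff_le[OF fb \<beta>S \<beta>S, of m n] \<beta>S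
        by (simp del: kform_simps)
    qed
    have "\<exists>N. \<forall>m\<ge>N. \<forall>n\<ge>N. sqrt (ip (?d (k (\<beta> m)) (k (\<beta> n)), ?d (k (\<beta> m)) (k (\<beta> n)))) < \<epsilon>"
      if "\<epsilon> > 0" for \<epsilon>
    proof -
      have "\<forall>\<^sub>F n in sequentially. ?e n < \<epsilon>\<^sup>2 / 4"
        using that by (intro order_tendstoD[OF e0]) auto
      then obtain N where N: "\<And>n. n \<ge> N \<Longrightarrow> ?e n < \<epsilon>\<^sup>2 / 4"
        by (auto simp: eventually_sequentially)
      have "sqrt (ip (?d (k (\<beta> m)) (k (\<beta> n)), ?d (k (\<beta> m)) (k (\<beta> n)))) < \<epsilon>" if "m \<ge> N" "n \<ge> N" for m n
      proof -
        have "ip (?d (k (\<beta> m)) (k (\<beta> n)), ?d (k (\<beta> m)) (k (\<beta> n))) < \<epsilon>\<^sup>2"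
          using close[of m n] N[OF that(1)] N[OF that(2)] by linarith
        then have "sqrt (ip (?d (k (\<beta> m)) (k (\<beta> n)), ?d (k (\<beta> m)) (k (\<beta> n)))) < sqrt (\<epsilon>\<^sup>2)"
          by (rule real_sqrt_less_mono)
        then show ?thesis using \<open>\<epsilon> > 0\<close> by simp
      qed
      then show ?thesis by blast
    qed
    moreover have "k (\<beta> n) \<in> H" for n using k[OF \<beta>S] by blast
    ultimately obtain g where g: "g \<in> H"
        and "(\<lambda>n. sqrt (ip (?d (k (\<beta> n)) g, ?d (k (\<beta> n)) g))) \<longlonglongrightarrow> 0"
      using hilbert_function_space_complete[OF hs, of "\<lambda>n. k (\<beta> n)"] by blast
    then have "(\<lambda>n. (sqrt (ip (?d (k (\<beta> n)) g, ?d (k (\<beta> n)) g)))\<^sup>2) \<longlonglongrightarrow> 0\<^sup>2"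
      by (intro tendsto_power)
    moreover have dH: "?d (k (\<beta> n)) g \<in> H" for n
      using hilbert_function_space_lincomb(1)[OF hs _ g, of "k (\<beta> n)" "-1"] k[OF \<beta>S] by simp
    moreover have "ip (?d (k (\<beta> n)) g, ?d (k (\<beta> n)) g) \<ge> 0" for n
      using dH hs unfolding hilbert_function_space_def by blast
    ultimately have d0: "(\<lambda>n. ip (?d (k (\<beta> n)) g, ?d (k (\<beta> n)) g)) \<longlonglongrightarrow> 0"
      by simp
    have weak: "(\<lambda>n. ip (k (\<beta> n), h)) \<longlonglongrightarrow> ip (g, h)" if h: "h \<in> H" for h
    proof -
      have "(\<lambda>n. ip (?d (k (\<beta> n)) g, h)) \<longlonglongrightarrow> 0"
      proof (rule tendsto_zero_of_sq_le)
        show "(ip (?d (k (\<beta> n)) g, h))\<^sup>2 \<le> ip (?d (k (\<beta> n)) g, ?d (k (\<beta> n)) g) * ip (h, h)" for n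
          by (rule hilbert_function_space_Cauchy_Schwarz[OF hs dH h])
        show "(\<lambda>n. ip (?d (k (\<beta> n)) g, ?d (k (\<beta> n)) g) * ip (h, h)) \<longlonglongrightarrow> 0"
          using tendsto_mult[OF d0 tendsto_const[of "ip (h, h)"]] by simp
      qed
      moreover have "ip (?d (k (\<beta> n)) g, h) = ip (k (\<beta> n), h) - ip (g, h)" for n
        using hilbert_function_space_lincomb(2)[OF hs _ g h, of "k (\<beta> n)" "-1"] k[OF \<beta>S] by simp
      ultimately show ?thesis by (simp add: LIM_zero_iff)
    qed
    have "f t = g t" if t: "t \<in> S" for t
    proof -
      have kt: "(\<lambda>s\<in>S. K (t, s)) \<in> H" "\<And>f. f \<in> H \<Longrightarrow> ip (f, (\<lambda>s\<in>S. K (t, s))) = f t"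
        using rkhs t by (auto simp: is_rkhs_def)
      have "(\<lambda>n. k (\<beta> n) t) \<longlonglongrightarrow> g t"
        using weak[OF kt(1)] kt(2) g k[OF \<beta>S] by simp
      then have 1: "(\<lambda>n. kcomb K (\<beta> n) t) \<longlonglongrightarrow> g t"
        using t by (simp add: k_def)
      have "(\<lambda>n. f t - kcomb K (\<beta> n) t) \<longlonglongrightarrow> 0"
      proof (rule tendsto_zero_of_sq_le)
        show "(f t - kcomb K (\<beta> n) t)\<^sup>2 \<le> ?e n * K (t, t)" for n
          by (rule rk_eval_sq_le[OF rk_shift_le(1)[OF fb \<beta>S] t])
        show "(\<lambda>n. ?e n * K (t, t)) \<longlonglongrightarrow> 0"
          using tendsto_mult[OF e0 tendsto_const[of "K (t, t)"]] by simp
      qed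
      from tendsto_add[OF this 1] show ?thesis
        by (simp add: LIMSEQ_const_iff)
    qed
    then have "restrict f S = restrict g S" by (intro restrict_ext) auto
    moreover have "restrict f S = f"
      using f unfolding rk_space_def by (auto dest: PiE_restrict)
    ultimately have fg: "f = g" using ext[OF g] by simp
    have "ip (f, h) = rk_ip f h" if h: "h \<in> H" for h
    proof -
      have "ip (k (\<beta> n), h) = ev h (\<beta> n)" for n
        using k[OF \<beta>S, of n] sym[OF _ h, of "k (\<beta> n)"] h by simp
      then show ?thesis
        using rk_ip_eqI[OF fb bounded[OF h] \<beta>] weak[OF h] fg by simp
    qed
    then show ?thesis using g fg by blast
  qed
  show H: "H = rk_space"
  proof
    show "rk_space \<subseteq> H" using main by blast
    have "H \<subseteq> S \<rightarrow>\<^sub>E UNIV" using hs unfolding hilbert_function_space_def by blast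
    then show "H \<subseteq> rk_space" using bounded by (auto simp: rk_space_def)
  qed
  have "ip \<in> H \<times> H \<rightarrow>\<^sub>E UNIV" using hs unfolding hilbert_function_space_def by blast
  then show "ip = rk_inner"
    unfolding H by (rule PiE_ext[of _ _ "\<lambda>_. UNIV"]) (use main H in \<open>auto simp: rk_inner_def\<close>)
qed

lemma rkhs_eq: "rkhs S K = (rk_space, rk_inner)"
  unfolding rkhs_def
proof (rule the_equality)
  show "p = (rk_space, rk_inner)" if "case p of (H, ip) \<Rightarrow> is_rkhs S K H ip" for p
  proof (cases p)
    case (Pair H ip)
    with that have "is_rkhs S K H ip" by simp
    from is_rkhs_unique[OF this] Pair show ?thesis by (simp only:)
  qed
qed (simp add: is_rkhs_rk_space)

lemma rkhs_inner_eq: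
  "rk_bounded S K f \<Longrightarrow> rk_bounded S K g \<Longrightarrow> rkhs_inner S K f g = rk_ip f g"
  by (simp add: rkhs_inner_def rkhs_eq rk_inner_restrict)

end

section \<open>Separation by a set of points\<close>

text \<open>
The conditions that determine the Hilbert space mention \<open>K\<close> at points of \<open>D\<close> alone. Restrictions of
the kernel and of the two functions to \<open>D\<close> may therefore be inserted or dropped freely.
\<close>

lemma rkhs_inner_cong:
  assumes "\<And>u. u \<in> D \<Longrightarrow> f u = f' u" "\<And>u. u \<in> D \<Longrightarrow> g u = g' u"
    and K: "\<And>u v. u \<in> D \<Longrightarrow> v \<in> D \<Longrightarrow> K (u, v) = K' (u, v)"
  shows "rkhs_inner D K f g = rkhs_inner D K' f' g'"
proof -
  have "(\<lambda>s\<in>D. K (t, s)) = (\<lambda>s\<in>D. K' (t, s))" if "t \<in> D" for t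
    using K[OF that] by (intro restrict_ext)
  then have "is_rkhs D K H ip = is_rkhs D K' H ip" for H ip
    unfolding is_rkhs_def by (simp cong: ball_cong del: restrict_apply)
  then have "rkhs D K = rkhs D K'" by (simp add: rkhs_def)
  moreover have "restrict f D = restrict f' D" "restrict g D = restrict g' D"
    using assms by (auto intro: restrict_ext)
  ultimately show ?thesis by (simp add: rkhs_inner_def)
qed

text \<open>
For a kernel that is positive on a set containing \<open>D\<close>, \<open>s\<close> and \<open>t\<close>, with feature vectors such that
\<open>\<langle>k\<^sub>s, k\<^sub>t\<rangle> = K(s, t)\<close>, this says that the residual of \<open>k\<^sub>s\<close> after
projection to the closed span of the \<open>k\<^sub>u\<close>, \<open>u \<in> D\<close>, is orthogonal to \<open>k\<^sub>t\<close>: for a Gaussian process,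
conditional independence of the values at \<open>s\<close> and \<open>t\<close> given those on \<open>D\<close>.
\<close>

definition separates :: "('a \<times> 'a \<Rightarrow> real) \<Rightarrow> 'a set \<Rightarrow> 'a \<Rightarrow> 'a \<Rightarrow> bool" where
  "separates K D s t \<longleftrightarrow> K (s, t) = rkhs_inner D K (\<lambda>u. K (s, u)) (\<lambda>u. K (t, u))"

lemma separates_cong:
  assumes "D \<subseteq> T" "s \<in> T" "t \<in> T" "\<And>u v. u \<in> T \<Longrightarrow> v \<in> T \<Longrightarrow> K (u, v) = K' (u, v)"
  shows "separates K D s t \<longleftrightarrow> separates K' D s t"
proof -
  have "rkhs_inner D K (\<lambda>u. K (s, u)) (\<lambda>u. K (t, u)) = rkhs_inner D K' (\<lambda>u. K' (s, u)) (\<lambda>u. K' (t, u))"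
    using assms by (intro rkhs_inner_cong) auto
  then show ?thesis using assms by (simp add: separates_def)
qed

text \<open>
Passing from \<open>T\<close> to \<open>D\<close> shrinks the set of combinations over which the supremum is taken, so it cannot
increase the norm. In particular the sections \<open>K(t, \<cdot>)\<close> with \<open>t\<close> outside \<open>D\<close> may enter the inner
product over \<open>D\<close>.
\<close>

lemma kcomb_bounded_on_subset:
  assumes T: "positive_kernel T K" and D: "D \<subseteq> T" and w: "w \<in> combos T"
  shows "rk_bounded D K (kcomb K w)" "rk_sqnorm D K (kcomb K w) \<le> kform K w w"
proof -
  interpret T: positive_kernel T K by fact
  have "2 * ev (kcomb K w) v - kform K v v \<le> kform K w w" if "v \<in> combos D" for v
    using rk_upper[OF T.rk_kcomb(1)[OF w] combos_mono[OF that D]] T.rk_kcomb(2)[OF w] by simp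
  then show "rk_bounded D K (kcomb K w)" "rk_sqnorm D K (kcomb K w) \<le> kform K w w"
    by (auto intro: rk_least)
qed

lemma section_bounded_on_subset:
  assumes "positive_kernel T K" "D \<subseteq> T" "t \<in> T"
  shows "rk_bounded D K (\<lambda>u. K (t, u))"
  using kcomb_bounded_on_subset(1)[OF assms(1,2), of "[(t, 1)]"] assms(3) by simp

context positive_kernel
begin

lemma rk_ip_kcomb_section:
  assumes T: "positive_kernel T K" and S: "S \<subseteq> T" and v: "v \<in> combos T" and g: "rk_bounded S K g"
  shows "rk_ip (kcomb K v) g = ev (\<lambda>s. rk_ip (\<lambda>u. K (s, u)) g) v"
  using v
proof (induction v)
  case Nil
  show ?case using rk_ip_kcomb_left[of "[]" g] g by simp
next
  case (Cons p v)
  obtain s a where p: "p = (s, a)" by fastforce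
  have s: "rk_bounded S K (\<lambda>u. K (s, u))" and v: "rk_bounded S K (kcomb K v)"
    using section_bounded_on_subset[OF T S] kcomb_bounded_on_subset(1)[OF T S] Cons.prems p by auto
  show ?case
    using Cons rk_ip_add_left[OF rk_cmult(1)[OF s] v g, of a] rk_ip_cmult_left[OF s g, of a] p by simp
qed

end

lemma separates_iff_rk_ip:
  assumes "positive_kernel A K" "D \<subseteq> A" "positive_kernel B K" "D \<subseteq> B" "s \<in> A" "t \<in> B"
  shows "separates K D s t \<longleftrightarrow> K (s, t) = positive_kernel.rk_ip D K (\<lambda>u. K (s, u)) (\<lambda>u. K (t, u))"
proof -
  interpret D: positive_kernel D K by (rule positive_kernel_subset) fact+
  show ?thesis
    unfolding separates_def
    using D.rkhs_inner_eq[of "\<lambda>u. K (s, u)" "\<lambda>u. K (t, u)"]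
      section_bounded_on_subset[OF assms(1,2,5)] section_bounded_on_subset[OF assms(3,4,6)] by simp
qed

lemma separates_sym:
  assumes "positive_kernel A K" "D \<subseteq> A" "positive_kernel B K" "D \<subseteq> B" "s \<in> A" "t \<in> B"
    and "K (s, t) = K (t, s)"
  shows "separates K D s t \<longleftrightarrow> separates K D t s"
proof -
  interpret D: positive_kernel D K by (rule positive_kernel_subset) fact+
  have "D.rk_ip (\<lambda>u. K (s, u)) (\<lambda>u. K (t, u)) = D.rk_ip (\<lambda>u. K (t, u)) (\<lambda>u. K (s, u))"
    by (intro D.rk_ip_sym section_bounded_on_subset[OF assms(1,2,5)]
        section_bounded_on_subset[OF assms(3,4,6)])
  then show ?thesis
    using separates_iff_rk_ip[OF assms(1-6)] separates_iff_rk_ip[OF assms(3,4,1,2,6,5)] assms(7) by simp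
qed

text \<open>
This is the reproducing property: a point of \<open>D\<close> is its own projection.
\<close>

lemma separates_of_mem:
  assumes A: "positive_kernel A K" and D: "D \<subseteq> A" and s: "s \<in> D" and t: "t \<in> A"
  shows "separates K D s t"
proof -
  interpret A: positive_kernel A K by fact
  interpret D: positive_kernel D K by (rule positive_kernel_subset) fact+
  have "D.rk_ip (kcomb K [(s, 1)]) (\<lambda>u. K (t, u)) = ev (\<lambda>u. K (t, u)) [(s, 1)]"
    using s by (intro D.rk_ip_kcomb_left section_bounded_on_subset[OF A D t]) simp
  then show ?thesis
    using separates_iff_rk_ip[OF A D A D _ t, of s] A.kernel_sym[OF t, of s] s D by auto
qed

text \<open>
The contraction property of conditional independence. Let \<open>P\<^sub>C\<close> and \<open>P\<^sub>D\<close> be the projections of feature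
vectors. The first hypothesis says that \<open>k\<^sub>s - P\<^sub>C k\<^sub>s\<close> is orthogonal to the span of \<open>D\<close>, so
\<open>P\<^sub>D k\<^sub>s = P\<^sub>D P\<^sub>C k\<^sub>s\<close>; the second allows \<open>P\<^sub>D\<close> to be dropped from vectors in the span of \<open>C\<close> when paired
with \<open>k\<^sub>t\<close>. Hence
\<open>K(s, t) = \<langle>P\<^sub>D k\<^sub>s, k\<^sub>t\<rangle> = \<langle>P\<^sub>D P\<^sub>C k\<^sub>s, k\<^sub>t\<rangle> = \<langle>P\<^sub>C k\<^sub>s, k\<^sub>t\<rangle>\<close>. The proof replaces \<open>P\<^sub>C k\<^sub>s\<close> by combinations of
kernel sections over \<open>C\<close> that approximate \<open>K(s, \<cdot>)\<close> on \<open>C\<close>; the first hypothesis ensures that the same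
combinations approximate \<open>K(s, \<cdot>)\<close> on \<open>D\<close> at least as well.
\<close>

lemma separates_trans:
  assumes T: "positive_kernel T K" and C: "C \<subseteq> T" and D: "D \<subseteq> T" and s: "s \<in> T" and t: "t \<in> T"
    and sD: "\<And>u. u \<in> D \<Longrightarrow> separates K C s u"
    and Ct: "\<And>c. c \<in> C \<Longrightarrow> separates K D c t"
    and st: "separates K D s t"
  shows "separates K C s t"
proof -
  interpret T: positive_kernel T K by fact
  interpret C: positive_kernel C K by (rule positive_kernel_subset) fact+
  interpret D: positive_kernel D K by (rule positive_kernel_subset) fact+
  define f where "f = (\<lambda>s u. K (s, u))"
  have fC: "rk_bounded C K (f x)" and fD: "rk_bounded D K (f x)" if "x \<in> T" for x
    unfolding f_def by (intro section_bounded_on_subset[OF T] C D that)+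
  have sep_C: "separates K C x y \<longleftrightarrow> K (x, y) = C.rk_ip (f x) (f y)"
    and sep_D: "separates K D x y \<longleftrightarrow> K (x, y) = D.rk_ip (f x) (f y)" if "x \<in> T" "y \<in> T" for x y
    using separates_iff_rk_ip[OF T C T C that] separates_iff_rk_ip[OF T D T D that]
    by (simp_all add: f_def)
  obtain \<beta> where \<beta>: "C.approximates \<beta> (f s)"
    using C.approximates_exists[OF fC[OF s]] by blast
  then have \<beta>C: "\<beta> n \<in> combos C" for n by (simp add: C.approximates_def)
  have \<beta>T: "\<beta> n \<in> combos T" for n using combos_mono[OF \<beta>C C] .
  let ?r = "\<lambda>n x. f s x - kcomb K (\<beta> n) x"
  have rC: "rk_bounded C K (?r n)" and rD: "rk_bounded D K (?r n)" for n
    by (intro C.rk_diff(1) D.rk_diff(1) fC fD s kcomb_bounded_on_subset(1)[OF T] C D \<beta>T)+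
  \<comment> \<open>Pairing the residual with a combination over \<open>D\<close> amounts to an inner product over \<open>C\<close>.\<close>
  have contraction: "rk_sqnorm D K (?r n) \<le> rk_sqnorm C K (?r n)" for n
  proof (rule D.rk_bound_of_sq_le(2)[OF rk_sqnorm_nonneg[OF rC]])
    fix w assume w: "w \<in> combos D"
    have wT: "w \<in> combos T" using combos_mono[OF w D] .
    note kw = kcomb_bounded_on_subset[OF T C wT]
    have "C.rk_ip (f s) (kcomb K w) = ev (\<lambda>u. C.rk_ip (f u) (f s)) w"
      using C.rk_ip_kcomb_section[OF T C wT fC[OF s]] C.rk_ip_sym[OF fC[OF s] kw(1)] by (simp add: f_def)
    also have "\<dots> = ev (f s) w"
    proof (rule ev_cong[OF w])
      fix u assume u: "u \<in> D"
      then have uT: "u \<in> T" using D by blast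
      show "C.rk_ip (f u) (f s) = f s u"
        using sD[OF u] sep_C[OF s uT] C.rk_ip_sym[OF fC[OF s] fC[OF uT]] by (simp add: f_def)
    qed
    finally have 1: "C.rk_ip (f s) (kcomb K w) = ev (f s) w" .
    have 2: "C.rk_ip (kcomb K (\<beta> n)) (kcomb K w) = ev (kcomb K (\<beta> n)) w"
      using C.rk_ip_kcomb_left[OF \<beta>C kw(1)] T.kform_sym[OF \<beta>T wT] by (simp add: ev_kcomb)
    have "ev (?r n) w = C.rk_ip (?r n) (kcomb K w)"
      using C.rk_ip_diff_left[OF fC[OF s] C.rk_kcomb(1)[OF \<beta>C] kw(1)] 1 2 by (simp add: ev_diff)
    then have "(ev (?r n) w)\<^sup>2 \<le> rk_sqnorm C K (?r n) * rk_sqnorm C K (kcomb K w)"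
      using C.rk_ip_Cauchy_Schwarz[OF rC kw(1)] by simp
    also have "\<dots> \<le> rk_sqnorm C K (?r n) * kform K w w"
      by (intro mult_left_mono kw(2) rk_sqnorm_nonneg rC)
    finally show "(ev (?r n) w)\<^sup>2 \<le> rk_sqnorm C K (?r n) * kform K w w" .
  qed
  have diff: "K (s, t) - ev (f t) (\<beta> n) = D.rk_ip (?r n) (f t)" for n
  proof -
    have "ev (f t) (\<beta> n) = ev (\<lambda>c. D.rk_ip (f c) (f t)) (\<beta> n)"
    proof (rule ev_cong[OF \<beta>C])
      fix c assume c: "c \<in> C"
      then have cT: "c \<in> T" using C by blast
      show "f t c = D.rk_ip (f c) (f t)"
        using Ct[OF c] sep_D[OF cT t] T.kernel_sym[OF t cT] by (simp add: f_def)
    qed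
    also have "\<dots> = D.rk_ip (kcomb K (\<beta> n)) (f t)"
      using D.rk_ip_kcomb_section[OF T D \<beta>T fD[OF t]] by (simp add: f_def)
    finally show ?thesis
      using D.rk_ip_diff_left[OF fD[OF s] kcomb_bounded_on_subset(1)[OF T D \<beta>T] fD[OF t]]
        st sep_D[OF s t] by simp
  qed
  have "(\<lambda>n. K (s, t) - ev (f t) (\<beta> n)) \<longlonglongrightarrow> 0"
  proof (rule tendsto_zero_of_sq_le)
    show "(K (s, t) - ev (f t) (\<beta> n))\<^sup>2 \<le> rk_sqnorm C K (?r n) * rk_sqnorm D K (f t)" for n
    proof -
      have "(K (s, t) - ev (f t) (\<beta> n))\<^sup>2 \<le> rk_sqnorm D K (?r n) * rk_sqnorm D K (f t)"
        unfolding diff by (rule D.rk_ip_Cauchy_Schwarz[OF rD fD[OF t]])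
      also have "\<dots> \<le> rk_sqnorm C K (?r n) * rk_sqnorm D K (f t)"
        by (intro mult_right_mono contraction rk_sqnorm_nonneg fD t)
      finally show ?thesis .
    qed
    have "(\<lambda>n. rk_sqnorm C K (?r n)) \<longlonglongrightarrow> 0"
      using \<beta> by (simp add: C.approximates_def)
    then show "(\<lambda>n. rk_sqnorm C K (?r n) * rk_sqnorm D K (f t)) \<longlonglongrightarrow> 0"
      by (rule tendsto_mult_left_zero)
  qed
  then have "(\<lambda>n. ev (f t) (\<beta> n)) \<longlonglongrightarrow> K (s, t)"
    using tendsto_diff[OF tendsto_const[of "K (s, t)"]] by fastforce
  then have "K (s, t) = C.rk_ip (f s) (f t)"
    using C.rk_ip_limit[OF fC[OF s] fC[OF t] \<beta>] LIMSEQ_unique by blast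
  then show ?thesis using sep_C[OF s t] by blast
qed

lemma ev_filter: "ev f (filter P v) + ev f (filter (\<lambda>p. \<not> P p) v) = ev f v"
  by (induction v) (auto simp: ev_def)

text \<open>
A combination over \<open>A \<union> B\<close> splits into a part \<open>a\<close> over \<open>A\<close> and a part \<open>b\<close> over \<open>B\<close>. Separation turns the
cross term into the inner product over \<open>A \<inter> B\<close> of the restrictions of \<open>k\<^sub>a\<close> and \<open>k\<^sub>b\<close>, while the diagonal
terms dominate the squared norms of these restrictions. The form is therefore at least the squared
norm of the sum of the restrictions.
\<close>

lemma positive_kernel_glue:
  assumes A: "positive_kernel A K" and B: "positive_kernel B K"
    and sym: "\<And>s t. s \<in> A \<Longrightarrow> t \<in> B \<Longrightarrow> K (s, t) = K (t, s)"
    and sep: "\<And>s t. s \<in> A \<Longrightarrow> t \<in> B \<Longrightarrow> separates K (A \<inter> B) s t"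
  shows "positive_kernel (A \<union> B) K"
proof
  interpret A: positive_kernel A K by fact
  interpret B: positive_kernel B K by fact
  let ?D = "A \<inter> B"
  have DA: "?D \<subseteq> A" and DB: "?D \<subseteq> B" by auto
  interpret D: positive_kernel ?D K by (rule positive_kernel_subset[OF A DA])
  show "K (s, t) = K (t, s)" if "s \<in> A \<union> B" "t \<in> A \<union> B" for s t
    using that sym[of s t] sym[of t s] A.kernel_sym B.kernel_sym by fastforce
  fix v assume v: "v \<in> combos (A \<union> B)"
  define a where "a = filter (\<lambda>p. fst p \<in> A) v"
  define b where "b = filter (\<lambda>p. fst p \<notin> A) v"
  have aA: "a \<in> combos A" and bB: "b \<in> combos B"
    using v by (auto simp: a_def b_def combos_def)
  have split: "ev f v = ev f a + ev f b" for f
    using ev_filter[of f "\<lambda>p. fst p \<in> A" v] by (simp add: a_def b_def)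
  have "kform K v v = kform K a a + kform K a b + (kform K b a + kform K b b)"
    by (simp add: kform_def kcomb_def split ev_add)
  moreover have cross: "kform K a b = D.rk_ip (kcomb K a) (kcomb K b)"
  proof -
    note a = kcomb_bounded_on_subset(1)[OF A DA aA] and b = kcomb_bounded_on_subset(1)[OF B DB bB]
    have "kform K a b = ev (\<lambda>t. D.rk_ip (\<lambda>u. K (t, u)) (kcomb K a)) b"
      unfolding kform_def
    proof (rule ev_cong[OF bB])
      fix t assume t: "t \<in> B"
      note ft = section_bounded_on_subset[OF B DB t]
      have "kcomb K a t = ev (\<lambda>s. D.rk_ip (\<lambda>u. K (s, u)) (\<lambda>u. K (t, u))) a"
        unfolding kcomb_def
        by (rule ev_cong[OF aA]) (use sep[OF _ t] separates_iff_rk_ip[OF A DA B DB _ t] in simp)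
      also have "\<dots> = D.rk_ip (kcomb K a) (\<lambda>u. K (t, u))"
        by (rule D.rk_ip_kcomb_section[OF A DA aA ft, symmetric])
      finally show "kcomb K a t = D.rk_ip (\<lambda>u. K (t, u)) (kcomb K a)"
        using D.rk_ip_sym[OF a ft] by simp
    qed
    also have "\<dots> = D.rk_ip (kcomb K b) (kcomb K a)"
      by (rule D.rk_ip_kcomb_section[OF B DB bB a, symmetric])
    finally show ?thesis using D.rk_ip_sym[OF a b] by simp
  qed
  moreover have "kform K b a = kform K a b"
  proof -
    have "kform K b a = ev (\<lambda>t. ev (\<lambda>s. K (s, t)) a) b"
      unfolding kform_def kcomb_def
      by (subst ev_swap) (intro ev_cong[OF bB] ev_cong[OF aA], simp add: sym)
    then show ?thesis by (simp add: kform_def kcomb_def)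
  qed
  moreover have "0 \<le> rk_sqnorm ?D K (kcomb K a) + 2 * D.rk_ip (kcomb K a) (kcomb K b)
      + rk_sqnorm ?D K (kcomb K b)"
  proof -
    note a = kcomb_bounded_on_subset(1)[OF A DA aA] and b = kcomb_bounded_on_subset(1)[OF B DB bB]
    note ab = D.rk_add(1)[OF a b]
    have "rk_sqnorm ?D K (\<lambda>x. kcomb K a x + kcomb K b x)
        = rk_sqnorm ?D K (kcomb K a) + 2 * D.rk_ip (kcomb K a) (kcomb K b) + rk_sqnorm ?D K (kcomb K b)"
      unfolding D.rk_ip_self[OF ab, symmetric] D.rk_ip_add_left[OF a b ab]
        D.rk_ip_add_right[OF a a b] D.rk_ip_add_right[OF b a b] D.rk_ip_sym[OF b a]
        D.rk_ip_self[OF a] D.rk_ip_self[OF b] by simp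
    then show ?thesis using rk_sqnorm_nonneg[OF ab] by simp
  qed
  ultimately show "0 \<le> kform K v v"
    using kcomb_bounded_on_subset(2)[OF A DA aA] kcomb_bounded_on_subset(2)[OF B DB bB] by linarith
qed

section \<open>Blocks of successive intervals\<close>

definition precedes :: "real set \<Rightarrow> real set \<Rightarrow> bool" where
  "precedes P Q \<longleftrightarrow> (\<forall>x \<in> P - Q. \<forall>y \<in> Q. x < y) \<and> (\<forall>y \<in> Q - P. \<forall>x \<in> P. x < y)"

lemma natural_order_iff_sorted_wrt: "natural_order As \<longleftrightarrow> sorted_wrt precedes As"
  by (auto simp: natural_order_def sorted_wrt_iff_nth_less precedes_def)

text \<open>
Two adjacent blocks of intervals overlap only where their neighbouring members do: a common point of
\<open>P\<close> in the first block and \<open>Q\<close> in the second that misses the last member of the first would lie both to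
the left and to the right of that member, and symmetrically for the first member of the second. Hence the set that separates two merged blocks is
the overlap of two successive original intervals, whatever the order of the merges.
\<close>

lemma blocks_inter:
  assumes sorted: "sorted_wrt precedes (U @ W)" and ne: "U \<noteq> []" "W \<noteq> []" "{} \<notin> set (U @ W)"
  shows "\<Union>(set U) \<inter> \<Union>(set W) = last U \<inter> hd W"
proof
  show "last U \<inter> hd W \<subseteq> \<Union>(set U) \<inter> \<Union>(set W)"
    using last_in_set[OF ne(1)] hd_in_set[OF ne(2)] by blast
  show "\<Union>(set U) \<inter> \<Union>(set W) \<subseteq> last U \<inter> hd W"
  proof
    fix x assume "x \<in> \<Union>(set U) \<inter> \<Union>(set W)"
    then obtain P Q where P: "P \<in> set U" "x \<in> P" and Q: "Q \<in> set W" "x \<in> Q" by blast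
    have PL: "P = last U \<or> precedes P (last U)" and LQ: "precedes (last U) Q"
      using sorted P(1) Q(1) ne(1) by (cases U rule: rev_cases; auto simp: sorted_wrt_append)+
    have PH: "precedes P (hd W)" and HQ: "Q = hd W \<or> precedes (hd W) Q"
      using sorted P(1) Q(1) ne(2) by (cases W; auto simp: sorted_wrt_append)+
    obtain l h where l: "l \<in> last U" and h: "h \<in> hd W"
      using ne by (metis Un_iff all_not_in_conv hd_in_set last_in_set set_append)
    have "x \<in> last U"
      using PL LQ P(2) Q(2) l unfolding precedes_def by (meson DiffI less_asym)
    moreover have "x \<in> hd W"
      using PH HQ P(2) Q(2) h unfolding precedes_def by (meson DiffI less_asym)
    ultimately show "x \<in> last U \<inter> hd W" by blast
  qed
qed

text \<open>
An earlier block containing \<open>t\<close> would put \<open>t\<close> to the left of the interval of \<open>U\<close> around \<open>s\<close>, and a later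
block containing \<open>s\<close> would put \<open>s\<close> to the right of the interval of \<open>W\<close> around \<open>t\<close>; both contradict \<open>s < t\<close>. So
the values that a merge fills in are exactly those on \<open>(A - B) \<times> (B - A)\<close> and its transpose, for the
unions \<open>A\<close> and \<open>B\<close> of the two blocks.
\<close>

lemma undefined_before_merge:
  assumes sorted: "sorted_wrt precedes (concat P @ U @ W @ concat R)"
    and s: "s \<in> \<Union>(set U) - \<Union>(set W)" and t: "t \<in> \<Union>(set W) - \<Union>(set U)"
    and Z: "Z \<in> set (P @ U # W # R)"
  shows "\<not> (s \<in> \<Union>(set Z) \<and> t \<in> \<Union>(set Z))"
proof
  assume "s \<in> \<Union>(set Z) \<and> t \<in> \<Union>(set Z)"
  then obtain A B where A: "A \<in> set Z" "s \<in> A" and B: "B \<in> set Z" "t \<in> B" by blast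
  obtain u w where u: "u \<in> set U" "s \<in> u" "t \<notin> u" and w: "w \<in> set W" "t \<in> w" "s \<notin> w"
    using s t by blast
  have "precedes u w" using sorted u w by (auto simp: sorted_wrt_append)
  then have "s < t" using u w by (auto simp: precedes_def)
  consider "Z \<in> set P" | "Z = U" | "Z = W" | "Z \<in> set R" using Z by auto
  then show False
  proof cases
    case 1
    then have "precedes B u" using sorted u(1) B(1) by (auto simp: sorted_wrt_append)
    then have "t < s" using u B unfolding precedes_def by blast
    then show False using \<open>s < t\<close> by simp
  next
    case 4
    then have "precedes w A" using sorted w(1) A(1) by (auto simp: sorted_wrt_append)
    then have "t < s" using w A unfolding precedes_def by blast
    then show False using \<open>s < t\<close> by simp
  qed (use s t A B in blast)+
qed

text \<open>
The order-independent characterisation of what merging produces: at each cut of the block, the overlap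
of the two intervals next to the cut separates the intervals before the cut from those after it.
\<close>

definition cut_separated :: "real set list \<Rightarrow> (real \<times> real \<Rightarrow> real) \<Rightarrow> bool" where
  "cut_separated U K \<longleftrightarrow> (\<forall>xs ys. U = xs @ ys \<longrightarrow> xs \<noteq> [] \<longrightarrow> ys \<noteq> [] \<longrightarrow>
     (\<forall>s\<in>\<Union>(set xs). \<forall>t\<in>\<Union>(set ys). separates K (last xs \<inter> hd ys) s t))"

lemma cut_separatedD:
  "cut_separated (xs @ ys) K \<Longrightarrow> xs \<noteq> [] \<Longrightarrow> ys \<noteq> [] \<Longrightarrow> s \<in> \<Union>(set xs) \<Longrightarrow> t \<in> \<Union>(set ys)
    \<Longrightarrow> separates K (last xs \<inter> hd ys) s t"
  unfolding cut_separated_def by blast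

lemma last_subset: "xs \<noteq> [] \<Longrightarrow> last xs \<subseteq> \<Union>(set xs)"
  by (auto intro: last_in_set)

lemma hd_subset: "xs \<noteq> [] \<Longrightarrow> hd xs \<subseteq> \<Union>(set xs)"
  by (auto intro: hd_in_set)

lemma cut_separated_cong:
  assumes K: "\<And>s t. s \<in> \<Union>(set U) \<Longrightarrow> t \<in> \<Union>(set U) \<Longrightarrow> K (s, t) = K' (s, t)"
    and U: "cut_separated U K"
  shows "cut_separated U K'"
  unfolding cut_separated_def
proof (intro allI impI ballI)
  fix xs ys s t
  assume U_eq: "U = xs @ ys" and ne: "xs \<noteq> []" "ys \<noteq> []" and s: "s \<in> \<Union>(set xs)" and t: "t \<in> \<Union>(set ys)"
  have "separates K (last xs \<inter> hd ys) s t"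
    using cut_separatedD[OF U[unfolded U_eq] ne s t] .
  moreover have "last xs \<inter> hd ys \<subseteq> \<Union>(set U)" "s \<in> \<Union>(set U)" "t \<in> \<Union>(set U)"
    using last_subset[OF ne(1)] s t U_eq by auto
  ultimately show "separates K' (last xs \<inter> hd ys) s t"
    using separates_cong[of "last xs \<inter> hd ys" "\<Union>(set U)" s t K K'] K by blast
qed

text \<open>
Across a cut the values of the kernel are inner products of sections that reach only as far as the cut.
Inserting the intervals from right to left, the section of the left point is known because it stays
within one interval, and the section of the right point is known by induction.
\<close>

lemma cut_separated_unique:
  assumes pos: "positive_kernel (\<Union>(set U)) K" "positive_kernel (\<Union>(set U)) K'"
    and cut: "cut_separated U K" "cut_separated U K'"
    and eq: "\<And>A s t. A \<in> set U \<Longrightarrow> s \<in> A \<Longrightarrow> t \<in> A \<Longrightarrow> K (s, t) = K' (s, t)"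
    and st: "s \<in> \<Union>(set U)" "t \<in> \<Union>(set U)"
  shows "K (s, t) = K' (s, t)"
proof -
  interpret K: positive_kernel "\<Union>(set U)" K by fact
  interpret K': positive_kernel "\<Union>(set U)" K' by fact
  have "K (s, t) = K' (s, t)" if "U = pre @ zs" "s \<in> \<Union>(set zs)" "t \<in> \<Union>(set zs)" for pre zs s t
    using that
  proof (induction zs arbitrary: pre s t)
    case Nil
    then show ?case by simp
  next
    case (Cons A zs)
    have U_eq: "U = (pre @ [A]) @ zs" using Cons.prems(1) by simp
    note IH = Cons.IH[OF U_eq]
    have cross: "K (s, t) = K' (s, t)" if s: "s \<in> A" and t: "t \<in> \<Union>(set zs)" for s t
    proof -
      have ne: "zs \<noteq> []" using t by auto
      note hd = subsetD[OF hd_subset[OF ne]]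
      have AU: "A \<in> set U" using U_eq by simp
      let ?D = "A \<inter> hd zs"
      have sA: "s \<in> \<Union>(set (pre @ [A]))" using s by simp
      have "separates K ?D s t" "separates K' ?D s t"
        using cut_separatedD[OF cut(1)[unfolded U_eq] _ ne sA t]
          cut_separatedD[OF cut(2)[unfolded U_eq] _ ne sA t] by simp_all
      moreover have "rkhs_inner ?D K (\<lambda>u. K (s, u)) (\<lambda>u. K (t, u))
          = rkhs_inner ?D K' (\<lambda>u. K' (s, u)) (\<lambda>u. K' (t, u))"
        using eq[OF AU] s IH[OF t] hd by (intro rkhs_inner_cong) auto
      ultimately show ?thesis by (simp add: separates_def)
    qed
    consider "s \<in> A" "t \<in> A" | "s \<in> \<Union>(set zs)" "t \<in> \<Union>(set zs)"
      | "s \<in> A" "t \<in> \<Union>(set zs)" | "t \<in> A" "s \<in> \<Union>(set zs)"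
      using Cons.prems by auto
    then show ?case
    proof cases
      case 1
      then show ?thesis using eq[of A] U_eq by simp
    next
      case 2
      then show ?thesis by (rule IH)
    next
      case 3
      then show ?thesis by (rule cross)
    next
      case 4
      have "s \<in> \<Union>(set U)" "t \<in> \<Union>(set U)" using 4 U_eq by auto
      then show ?thesis
        using cross[OF 4] K.kernel_sym K'.kernel_sym by metis
    qed
  qed
  from this[of "[]" U] st show ?thesis by simp
qed

text \<open>
A cut inside \<open>U\<close> already separates points of \<open>U\<close>. To separate a point \<open>s\<close> of an interval before it from
a point of \<open>W\<close>, note that the cut separates \<open>s\<close> from the overlap of the two blocks, which is contained
in the interval \<open>last U\<close> after the cut, and that this overlap separates all of \<open>U\<close> from \<open>W\<close>; then apply \<open>separates_trans\<close>. Cuts inside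
\<open>W\<close> are symmetric.
\<close>

lemma cut_separated_append:
  assumes sorted: "sorted_wrt precedes (U @ W)" and ne: "U \<noteq> []" "W \<noteq> []" "{} \<notin> set (U @ W)"
    and pos: "positive_kernel (\<Union>(set (U @ W))) K"
    and U: "cut_separated U K" and W: "cut_separated W K"
    and UW: "\<And>s t. s \<in> \<Union>(set U) \<Longrightarrow> t \<in> \<Union>(set W) \<Longrightarrow> separates K (\<Union>(set U) \<inter> \<Union>(set W)) s t"
  shows "cut_separated (U @ W) K"
  unfolding cut_separated_def
proof (intro allI impI ballI)
  fix xs ys s t
  assume UW_eq: "U @ W = xs @ ys" and ne': "xs \<noteq> []" "ys \<noteq> []"
    and s: "s \<in> \<Union>(set xs)" and t: "t \<in> \<Union>(set ys)"
  let ?T = "\<Union>(set (U @ W))"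
  let ?D = "\<Union>(set U) \<inter> \<Union>(set W)"
  have D_eq: "?D = last U \<inter> hd W" by (rule blocks_inter) fact+
  interpret positive_kernel ?T K by fact
  have in_T: "x \<in> ?T" if "x \<in> \<Union>(set xs) \<or> x \<in> \<Union>(set ys)" for x
    using that unfolding UW_eq by auto
  have D_T: "?D \<subseteq> ?T" by auto
  have C_T: "last xs \<inter> hd ys \<subseteq> ?T" using last_subset[OF ne'(1)] in_T by blast
  note sT = in_T[OF disjI1, OF s] and tT = in_T[OF disjI2, OF t]
  have sym: "separates K E a b \<longleftrightarrow> separates K E b a" if "E \<subseteq> ?T" "a \<in> ?T" "b \<in> ?T" for E a b
    by (rule separates_sym[OF pos that(1) pos that(1-3) kernel_sym[OF that(2,3)]])
  consider zs where "xs = U @ zs" "W = zs @ ys" "zs \<noteq> []" | zs where "U = xs @ zs" "ys = zs @ W" "zs \<noteq> []"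
    | "xs = U" "ys = W"
    using UW_eq[unfolded append_eq_append_conv2] by (metis append.right_neutral append_Nil)
  then show "separates K (last xs \<inter> hd ys) s t"
  proof cases
    case 3
    then show ?thesis using UW s t D_eq by simp
  next
    case (2 zs)
    have C: "last xs \<inter> hd ys = last xs \<inter> hd zs" using 2 by simp
    have sU: "s \<in> \<Union>(set U)" using s 2 by auto
    have within: "separates K (last xs \<inter> hd zs) s u" if "u \<in> \<Union>(set zs)" for u
      using cut_separatedD[of xs zs K s u] U 2 ne'(1) s that by simp
    show ?thesis
    proof (cases "t \<in> \<Union>(set zs)")
      case True
      then show ?thesis using within C by simp
    next
      case False
      then have tW: "t \<in> \<Union>(set W)" using t 2 by auto
      show ?thesis
      proof (rule separates_trans[OF pos C_T D_T sT tT])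
        show "separates K (last xs \<inter> hd ys) s u" if "u \<in> ?D" for u
          using within[of u] that C last_subset[of zs] 2 unfolding D_eq by auto
        show "separates K ?D c t" if "c \<in> last xs \<inter> hd ys" for c
          using UW[OF _ tW, of c] that last_subset[OF ne'(1)] 2 by auto
        show "separates K ?D s t" by (rule UW[OF sU tW])
      qed
    qed
  next
    case (1 zs)
    have C: "last xs \<inter> hd ys = last zs \<inter> hd ys" using 1 by simp
    have tW: "t \<in> \<Union>(set W)" using t 1 by auto
    have within: "separates K (last zs \<inter> hd ys) u t" if "u \<in> \<Union>(set zs)" for u
      using cut_separatedD[of zs ys K u t] W 1 ne'(2) t that by simp
    show ?thesis
    proof (cases "s \<in> \<Union>(set zs)")
      case True
      then show ?thesis using within C by simp
    next
      case False
      then have sU: "s \<in> \<Union>(set U)" using s 1 by auto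
      have "separates K (last xs \<inter> hd ys) t s"
      proof (rule separates_trans[OF pos C_T D_T tT sT])
        show "separates K (last xs \<inter> hd ys) t u" if u: "u \<in> ?D" for u
        proof -
          have "u \<in> \<Union>(set zs)" using u hd_subset[of zs] 1 unfolding D_eq by auto
          then show ?thesis using within[of u] C sym[OF C_T tT, of u] u D_T by auto
        qed
        show "separates K ?D c s" if c: "c \<in> last xs \<inter> hd ys" for c
        proof -
          have "c \<in> \<Union>(set W)" using c hd_subset[OF ne'(2)] 1 by auto
          then show ?thesis using UW[OF sU] sym[OF D_T sT, of c] c C_T by blast
        qed
        show "separates K ?D t s" using UW[OF sU tW] sym[OF D_T sT tT] by blast
      qed
      then show ?thesis using sym[OF C_T sT tT] by blast
    qed
  qed
qed

section \<open>The merging procedure\<close>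

text \<open>
The invariant of the procedure. The current list of intervals is determined by the way in which the
merges have grouped the original list into consecutive blocks, recorded in \<open>Bs\<close>.
\<close>

definition merge_state ::
    "real set list \<Rightarrow> (real \<times> real \<Rightarrow> real) \<Rightarrow> real set list list \<Rightarrow> (real \<times> real \<Rightarrow> real) \<Rightarrow> bool" where
  "merge_state Is K\<^sub>0 Bs K \<longleftrightarrow>
     concat Bs = Is \<and> [] \<notin> set Bs \<and>
     K \<in> squares (map (\<lambda>U. \<Union>(set U)) Bs) \<rightarrow>\<^sub>E UNIV \<and> restrict K (squares Is) = K\<^sub>0 \<and>
     (\<forall>U\<in>set Bs. positive_kernel (\<Union>(set U)) K \<and> cut_separated U K)"

lemma squares_subset_blocks: "squares (concat Bs) \<subseteq> squares (map (\<lambda>U. \<Union>(set U)) Bs)"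
  by (fastforce simp: squares_def)

lemma merge_state_initial:
  assumes cover: "interval_cover I Is" and partial: "partial_covariance I (squares Is) K\<^sub>0"
  shows "merge_state Is K\<^sub>0 (map (\<lambda>A. [A]) Is) K\<^sub>0"
proof -
  have concat: "concat (map (\<lambda>A. [A]) Is) = Is" by (induction Is) auto
  have blocks: "map (\<lambda>U. \<Union>(set U)) (map (\<lambda>A. [A]) Is) = Is" by (induction Is) auto
  have K0: "K\<^sub>0 \<in> squares Is \<rightarrow>\<^sub>E UNIV" using partial by (simp add: partial_covariance_def)
  have "positive_kernel A K\<^sub>0" if A: "A \<in> set Is" for A
  proof -
    have "A \<subseteq> I" "A \<times> A \<subseteq> squares Is" using A cover by (auto simp: interval_cover_def squares_def)
    then show ?thesis
      using partial by (simp add: partial_covariance_def covariance_on_iff_positive_kernel)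
  qed
  moreover have "cut_separated [A] K\<^sub>0" for A
    by (auto simp: cut_separated_def Cons_eq_append_conv)
  moreover have "restrict K\<^sub>0 (squares Is) = K\<^sub>0" by (rule PiE_restrict[OF K0])
  ultimately show ?thesis
    unfolding merge_state_def concat blocks using K0 by auto
qed

text \<open>
The merge changes the kernel only at pairs of points that no current interval contained, so the invariant
persists for the other blocks and for the cuts inside the two merged blocks. The filled-in values
make the overlap separate the two blocks (\<open>cross\<close>; for points of the overlap this is the
reproducing property), and gluing and appending along this cut give the invariant for the new block.
\<close>

lemma merge_state_step:
  assumes sorted: "sorted_wrt precedes Is" and ne: "{} \<notin> set Is"
    and state: "merge_state Is K\<^sub>0 (P @ U # W # R) K"
    and K': "K' = merge_extension (map (\<lambda>U. \<Union>(set U)) (P @ U # W # R)) (\<Union>(set U)) (\<Union>(set W)) K"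
  shows "merge_state Is K\<^sub>0 (P @ (U @ W) # R) K'"
proof -
  let ?Bs = "P @ U # W # R" and ?Bs' = "P @ (U @ W) # R"
  let ?L = "map (\<lambda>U. \<Union>(set U)) ?Bs"
  let ?A = "\<Union>(set U)" and ?B = "\<Union>(set W)"
  let ?D = "?A \<inter> ?B"
  have Is_eq: "Is = concat P @ U @ W @ concat R" and UW_ne: "U \<noteq> []" "W \<noteq> []"
    and K_ext: "K \<in> squares ?L \<rightarrow>\<^sub>E UNIV" and K_K0: "restrict K (squares Is) = K\<^sub>0"
    using state by (auto simp: merge_state_def)
  have A: "positive_kernel ?A K" and B: "positive_kernel ?B K"
    using state by (auto simp: merge_state_def)
  have sorted': "sorted_wrt precedes (concat P @ U @ W @ concat R)" using sorted Is_eq by simp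
  then have sorted_UW: "sorted_wrt precedes (U @ W)" by (simp add: sorted_wrt_append)
  have ne_UW: "{} \<notin> set (U @ W)" using ne Is_eq by auto
  interpret A: positive_kernel ?A K by fact
  interpret B: positive_kernel ?B K by fact
  have DA: "?D \<subseteq> ?A" and DB: "?D \<subseteq> ?B" by auto
  interpret D: positive_kernel ?D K by (rule positive_kernel_subset[OF A DA])
  have old: "K' (s, t) = K (s, t)" if "(s, t) \<in> squares ?L" for s t
    using that by (simp add: K' merge_extension_def)
  have block: "K' (s, t) = K (s, t)" if "Z \<in> set ?Bs" "s \<in> \<Union>(set Z)" "t \<in> \<Union>(set Z)" for Z s t
    using that by (intro old) (auto simp: squares_def)
  have new: "K' (s, t) = rkhs_inner ?D K (\<lambda>u. K (s, u)) (\<lambda>u. K (t, u))"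
      "K' (t, s) = rkhs_inner ?D K (\<lambda>u. K (s, u)) (\<lambda>u. K (t, u))"
    if s: "s \<in> ?A - ?B" and t: "t \<in> ?B - ?A" for s t
  proof -
    have undefined: "(s, t) \<notin> squares ?L" "(t, s) \<notin> squares ?L"
      using undefined_before_merge[OF sorted' s t] by (auto simp: squares_def)
    have sA: "s \<in> ?A" and tB: "t \<in> ?B" using s t by auto
    note fs = section_bounded_on_subset[OF A DA sA] and ft = section_bounded_on_subset[OF B DB tB]
    have "K' (s, t) = rkhs_inner ?D (restrict K (?D \<times> ?D)) (\<lambda>u. K (s, u)) (\<lambda>u. K (u, t))"
      using undefined(1) sA tB by (simp add: K' merge_extension_def)
    also have "\<dots> = rkhs_inner ?D K (\<lambda>u. K (s, u)) (\<lambda>u. K (t, u))"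
      using B.kernel_sym[OF _ tB] by (intro rkhs_inner_cong) auto
    finally show "K' (s, t) = rkhs_inner ?D K (\<lambda>u. K (s, u)) (\<lambda>u. K (t, u))" .
    have "K' (t, s) = rkhs_inner ?D (restrict K (?D \<times> ?D)) (\<lambda>u. K (t, u)) (\<lambda>u. K (u, s))"
      using undefined(2) sA tB by (simp add: K' merge_extension_def)
    also have "\<dots> = rkhs_inner ?D K (\<lambda>u. K (t, u)) (\<lambda>u. K (s, u))"
      using A.kernel_sym[OF _ sA] by (intro rkhs_inner_cong) auto
    also have "\<dots> = rkhs_inner ?D K (\<lambda>u. K (s, u)) (\<lambda>u. K (t, u))"
      using D.rkhs_inner_eq[OF fs ft] D.rkhs_inner_eq[OF ft fs] D.rk_ip_sym[OF fs ft] by simp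
    finally show "K' (t, s) = rkhs_inner ?D K (\<lambda>u. K (s, u)) (\<lambda>u. K (t, u))" .
  qed
  have A_old: "K' (s, t) = K (s, t)" if "s \<in> ?A" "t \<in> ?A" for s t using block[of U] that by simp
  have B_old: "K' (s, t) = K (s, t)" if "s \<in> ?B" "t \<in> ?B" for s t using block[of W] that by simp
  have A': "positive_kernel ?A K'" using positive_kernel_cong[OF A] A_old by simp
  have B': "positive_kernel ?B K'" using positive_kernel_cong[OF B] B_old by simp
  interpret A': positive_kernel ?A K' by fact
  interpret B': positive_kernel ?B K' by fact
  have cross_sym: "K' (s, t) = K' (t, s)" if "s \<in> ?A" "t \<in> ?B" for s t
    using that new[of s t] A'.kernel_sym B'.kernel_sym by (cases "s \<in> ?B"; cases "t \<in> ?A") auto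
  have cross: "separates K' ?D s t" if s: "s \<in> ?A" and t: "t \<in> ?B" for s t
  proof -
    consider "s \<in> ?B" | "t \<in> ?A" | "s \<in> ?A - ?B" "t \<in> ?B - ?A" using s t by blast
    then show ?thesis
    proof cases
      case 1
      then show ?thesis using s t by (intro separates_of_mem[OF B' DB]) auto
    next
      case 2
      then have "separates K' ?D t s" using s t by (intro separates_of_mem[OF A' DA]) auto
      then show ?thesis
        using separates_sym[OF A' DA A' DA s 2 A'.kernel_sym[OF s 2]] by simp
    next
      case 3
      have "rkhs_inner ?D K (\<lambda>u. K (s, u)) (\<lambda>u. K (t, u))
          = rkhs_inner ?D K' (\<lambda>u. K' (s, u)) (\<lambda>u. K' (t, u))"
        using s t A_old B_old by (intro rkhs_inner_cong) auto
      then show ?thesis using new(1)[OF 3] by (simp add: separates_def)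
    qed
  qed
  have AB': "positive_kernel (\<Union>(set (U @ W))) K'"
    using positive_kernel_glue[OF A' B' cross_sym cross] by (simp add: Union_Un_distrib)
  have cut: "cut_separated Z K'" if "Z \<in> set ?Bs" for Z
  proof (rule cut_separated_cong)
    show "cut_separated Z K" using state that unfolding merge_state_def by blast
  qed (use block[OF that] in auto)
  have "cut_separated (U @ W) K'"
    using cut[of U] cut[of W] by (intro cut_separated_append sorted_UW UW_ne ne_UW AB' cross) auto
  moreover have "positive_kernel (\<Union>(set Z)) K' \<and> cut_separated Z K'" if "Z \<in> set P \<union> set R" for Z
  proof -
    have Z: "Z \<in> set ?Bs" using that by auto
    then have "positive_kernel (\<Union>(set Z)) K" using state unfolding merge_state_def by blast
    then have "positive_kernel (\<Union>(set Z)) K'"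
      by (rule positive_kernel_cong) (use block[OF Z] in auto)
    then show ?thesis using cut[OF Z] by blast
  qed
  moreover have "K' \<in> squares (map (\<lambda>U. \<Union>(set U)) ?Bs') \<rightarrow>\<^sub>E UNIV"
  proof -
    have "K' p = undefined" if p: "p \<notin> squares (map (\<lambda>U. \<Union>(set U)) ?Bs')" for p
    proof -
      obtain s t where st: "p = (s, t)" by fastforce
      have "p \<notin> squares ?L" and "p \<notin> (?A \<union> ?B) \<times> (?A \<union> ?B)"
        using p by (auto simp: squares_def)
      then show ?thesis
        using K_ext by (auto simp: K' merge_extension_def st PiE_def extensional_def)
    qed
    then show ?thesis by (auto simp: PiE_def extensional_def)
  qed
  moreover have "restrict K' (squares Is) = K\<^sub>0"
  proof -
    have "squares Is \<subseteq> squares ?L"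
      using squares_subset_blocks[of ?Bs] Is_eq by simp
    then have "restrict K' (squares Is) = restrict K (squares Is)"
      using old by (intro restrict_ext) auto
    then show ?thesis using K_K0 by simp
  qed
  ultimately show ?thesis
    using state AB' unfolding merge_state_def by auto
qed

lemma merge_state_reachable:
  assumes sorted: "sorted_wrt precedes Is" and ne: "{} \<notin> set Is"
    and init: "merge_state Is K\<^sub>0 (map (\<lambda>A. [A]) Is) K\<^sub>0"
    and steps: "merge_step\<^sup>*\<^sup>* (Is, K\<^sub>0) (L, K)"
  shows "\<exists>Bs. merge_state Is K\<^sub>0 Bs K \<and> L = map (\<lambda>U. \<Union>(set U)) Bs"
proof -
  have "\<exists>Bs. merge_state Is K\<^sub>0 Bs (snd q) \<and> fst q = map (\<lambda>U. \<Union>(set U)) Bs"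
    if "merge_step\<^sup>*\<^sup>* (Is, K\<^sub>0) q" for q
    using that
  proof (induction rule: rtranclp_induct)
    case base
    have "map (\<lambda>U. \<Union>(set U)) (map (\<lambda>A. [A]) Is) = Is" by (induction Is) auto
    then show ?case using init by (intro exI[of _ "map (\<lambda>A. [A]) Is"]) simp
  next
    case (step q r)
    from step.IH obtain Bs where Bs: "merge_state Is K\<^sub>0 Bs (snd q)" "fst q = map (\<lambda>U. \<Union>(set U)) Bs"
      by blast
    from step.hyps(2) show ?case
    proof cases
      case (1 xs A B ys K)
      then obtain P U W R where "Bs = P @ U # W # R" "xs = map (\<lambda>U. \<Union>(set U)) P"
          "A = \<Union>(set U)" "B = \<Union>(set W)" "ys = map (\<lambda>U. \<Union>(set U)) R"
        using Bs(2) by (auto simp: append_eq_map_conv Cons_eq_map_conv map_eq_append_conv map_eq_Cons_conv)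
      then show ?thesis
        using merge_state_step[OF sorted ne, of K\<^sub>0 P U W R K] Bs(1) 1
        by (intro exI[of _ "P @ (U @ W) # R"]) (auto simp: Union_Un_distrib)
    qed
  qed
  from this[OF steps] show ?thesis by simp
qed

lemma merging_terminates: "L \<noteq> [] \<Longrightarrow> \<exists>A K'. merge_step\<^sup>*\<^sup>* (L, K) ([A], K')"
proof (induction "length L" arbitrary: L K rule: less_induct)
  case less
  consider A where "L = [A]" | A B L' where "L = A # B # L'"
    using less.prems by (metis list.exhaust)
  then show ?case
  proof cases
    case 1
    then show ?thesis by blast
  next
    case (2 A B L')
    have "merge_step (L, K) ((A \<union> B) # L', merge_extension L A B K)"
      using merge_step.intros[of "[]" A B L' K] 2 by simp
    moreover obtain C K' where "merge_step\<^sup>*\<^sup>* ((A \<union> B) # L', merge_extension L A B K) ([C], K')"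
      using less.hyps[of "(A \<union> B) # L'" "merge_extension L A B K"] 2 by auto
    ultimately show ?thesis by (meson converse_rtranclp_into_rtranclp)
  qed
qed

theorem theorem3p3:
  fixes I :: "real set" and Is :: "real set list"
    and \<Omega> :: "(real \<times> real) set" and K\<^sub>\<Omega> :: "real \<times> real \<Rightarrow> real"
  assumes "is_interval I"
    and "interval_cover I Is"
    and "natural_order Is"
    and "\<Omega> = squares Is"
    and "partial_covariance I \<Omega> K\<^sub>\<Omega>"
  shows "\<exists>Kstar \<in> completions I \<Omega> K\<^sub>\<Omega>.
     merge_step\<^sup>*\<^sup>* (Is, K\<^sub>\<Omega>) ([I], Kstar) \<and>
     (\<forall>L K. merge_step\<^sup>*\<^sup>* (Is, K\<^sub>\<Omega>) (L, K) \<and> length L = 1 \<longrightarrow> L = [I] \<and> K = Kstar) \<and>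
     (\<forall>K. completions I \<Omega> K\<^sub>\<Omega> = {K} \<longrightarrow> K = Kstar)"
proof -
  have sorted: "sorted_wrt precedes Is" using assms(3) natural_order_iff_sorted_wrt by blast
  have ne: "{} \<notin> set Is" "Is \<noteq> []" and I: "I = \<Union>(set Is)"
    using assms(2) by (auto simp: interval_cover_def)
  have init: "merge_state Is K\<^sub>\<Omega> (map (\<lambda>A. [A]) Is) K\<^sub>\<Omega>"
    using merge_state_initial assms(2,4,5) by simp
  have final: "L = [I] \<and> merge_state Is K\<^sub>\<Omega> [Is] K"
    if steps: "merge_step\<^sup>*\<^sup>* (Is, K\<^sub>\<Omega>) (L, K)" and "length L = 1" for L K
  proof -
    obtain Bs where Bs: "merge_state Is K\<^sub>\<Omega> Bs K" "L = map (\<lambda>U. \<Union>(set U)) Bs"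
      using merge_state_reachable[OF sorted ne(1) init steps] by blast
    then obtain U where U: "Bs = [U]" using \<open>length L = 1\<close> by (auto simp: length_Suc_conv)
    then have "U = Is" using Bs(1) by (simp add: merge_state_def)
    then show ?thesis using Bs U I by simp
  qed
  have final_ext: "K \<in> I \<times> I \<rightarrow>\<^sub>E UNIV" and final_pos: "positive_kernel (\<Union>(set Is)) K"
    and final_cut: "cut_separated Is K" and final_K: "restrict K \<Omega> = K\<^sub>\<Omega>"
    if "merge_state Is K\<^sub>\<Omega> [Is] K" for K
    using that assms(4) I by (auto simp: merge_state_def squares_def)
  obtain A Kstar where reach: "merge_step\<^sup>*\<^sup>* (Is, K\<^sub>\<Omega>) ([A], Kstar)"
    using merging_terminates[OF ne(2)] by blast
  from final[OF this] have A: "A = I" and star: "merge_state Is K\<^sub>\<Omega> [Is] Kstar" by simp_all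
  have "covariance_on I (restrict Kstar (I \<times> I))"
    using final_pos[OF star] I by (simp add: covariance_on_iff_positive_kernel)
  moreover have "restrict Kstar (I \<times> I) = Kstar" by (rule PiE_restrict[OF final_ext[OF star]])
  ultimately have completion: "Kstar \<in> completions I \<Omega> K\<^sub>\<Omega>"
    using final_K[OF star] by (simp add: completions_def)
  have unique: "K = Kstar" if K: "merge_state Is K\<^sub>\<Omega> [Is] K" for K
  proof (rule PiE_ext[OF final_ext[OF K] final_ext[OF star]])
    fix p assume "p \<in> I \<times> I"
    then obtain s t where p: "p = (s, t)" and st: "s \<in> \<Union>(set Is)" "t \<in> \<Union>(set Is)" using I by auto
    have "K (s, t) = Kstar (s, t)"
    proof (rule cut_separated_unique[OF final_pos[OF K] final_pos[OF star] final_cut[OF K]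
          final_cut[OF star] _ st])
      fix A s t assume "A \<in> set Is" "s \<in> A" "t \<in> A"
      then have "(s, t) \<in> \<Omega>" using assms(4) by (auto simp: squares_def)
      then show "K (s, t) = Kstar (s, t)"
        using final_K[OF K] final_K[OF star] by (metis restrict_apply')
    qed
    then show "K p = Kstar p" using p by simp
  qed
  show ?thesis
  proof (intro bexI[OF _ completion] conjI allI impI)
    show "merge_step\<^sup>*\<^sup>* (Is, K\<^sub>\<Omega>) ([I], Kstar)"
      using reach unfolding A .
  next
    fix L K assume "merge_step\<^sup>*\<^sup>* (Is, K\<^sub>\<Omega>) (L, K) \<and> length L = 1"
    then have "L = [I]" "merge_state Is K\<^sub>\<Omega> [Is] K" using final by blast+
    then show "L = [I]" "K = Kstar" using unique by blast+
  next
    fix K assume "completions I \<Omega> K\<^sub>\<Omega> = {K}"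
    then have "Kstar \<in> {K}" using completion by (simp only:)
    then show "K = Kstar" by simp
  qed
qed

end
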